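(* Let $s$ be a positive integer, let $\Phi$ be an $m\times N$ complex matrix with restricted isometry constant $\delta_{4s}\le 0.1$, let $x\in\mathbb{C}^N$ and $e\in\mathbb{C}^m$ be arbitrary, and let $u = \Phi x + e$. Define $$\nu = \|x - x_s\|_2 + \frac{1}{\sqrt{s}}\|x - x_s\|_1 + \|e\|_2 .$$ Let $a^0, a^1, a^2,\dots$ be the approximations produced by CoSaMP with inputs $\Phi, u, s$. Then for each iteration $k\ge 0$ the signal approximation $a^k$ is $s$-sparse and $$\|x - a^{k+1}\|_2 \le 0.5\,\|x - a^k\|_2 + 10\nu .$$ In particular, $$\|x - a^k\|_2 \le 2^{-k}\|x\|_2 + 20\nu .$$
   Context: $\|x\|_0$ is the number of nonzero entries of $x$; $x$ is $r$-sparse if $\|x\|_0\le r$. The restricted isometry constant $\delta_r$ of $\Phi$ is the least number such that $(1-\delta_r)\|x\|_2^2 \le \|\Phi x\|_2^2 \le (1+\delta_r)\|x\|_2^2$ whenever $\|x\|_0\le r$. $x_r$ denotes the vector obtained from $x$ by keeping its $r$ largest-magnitude entries (ties broken lexicographically) and setting the others to zero. For an index set $T\subset\{1,\dots,N\}$, $x|_T$ agrees with $x$ on $T$ and is zero off $T$ (also viewed as an element of $\mathbb{C}^T$), $\Phi_T$ is the column submatrix of $\Phi$ with columns in $T$, and $A^\dagger = (A^*A)^{-1}A^*$ for a tall full-rank matrix $A$. CoSaMP with inputs $\Phi, u, s$: set $a^0=0$, $v=u$. For $k=1,2,3,\dots$: (1) $y=\Phi^*v$; (2) $\Omega=\operatorname{supp}(y_{2s})$;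 (3) $T=\Omega\cup\operatorname{supp}(a^{k-1})$; (4) $b|_T=\Phi_T^\dagger u$, $b|_{T^c}=0$; (5) $a^k=b_s$; (6) $v=u-\Phi a^k$. *)

theory Defs
  imports
    "Jordan_Normal_Form.Schur_Decomposition"
    "Jordan_Normal_Form.DL_Submatrix"
    "Jordan_Normal_Form.Gauss_Jordan_Elimination"
    "HOL-Analysis.L2_Norm"
begin

(* Vectors and matrices are indexed from 0, so the index set of C^N is {..<N}. *)

definition norm2_vec :: "complex vec \<Rightarrow> real" where
  "norm2_vec x = L2_set (\<lambda>i. cmod (x $ i)) {..<dim_vec x}"

definition norm1_vec :: "complex vec \<Rightarrow> real" where
  "norm1_vec x = (\<Sum>i<dim_vec x. cmod (x $ i))"

definition supp_vec :: "complex vec \<Rightarrow> nat set" where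
  "supp_vec x = {i. i < dim_vec x \<and> x $ i \<noteq> 0}"

definition norm0_vec :: "complex vec \<Rightarrow> nat" where
  "norm0_vec x = card (supp_vec x)"

definition sparse_vec :: "nat \<Rightarrow> complex vec \<Rightarrow> bool" where
  "sparse_vec r x \<longleftrightarrow> norm0_vec x \<le> r"

(* For r > 0 and dim_col A > 0 the least number exists; otherwise every real number satisfies
   the condition and the value is unspecified. *)
definition restricted_isometry_const :: "nat \<Rightarrow> complex mat \<Rightarrow> real" where
  "restricted_isometry_const r A = (LEAST \<delta>. \<forall>x \<in> carrier_vec (dim_col A). sparse_vec r x \<longrightarrow>
     (1 - \<delta>) * (norm2_vec x)\<^sup>2 \<le> (norm2_vec (A *\<^sub>v x))\<^sup>2 \<and>
     (norm2_vec (A *\<^sub>v x))\<^sup>2 \<le> (1 + \<delta>) * (norm2_vec x)\<^sup>2)"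

definition restrict_vec :: "complex vec \<Rightarrow> nat set \<Rightarrow> complex vec" where
  "restrict_vec x T = vec (dim_vec x) (\<lambda>i. if i \<in> T then x $ i else 0)"

(* sort_key is stable, so among entries of equal magnitude the smaller index comes first. *)
definition largest_indices :: "nat \<Rightarrow> complex vec \<Rightarrow> nat set" where
  "largest_indices r x = set (take r (sort_key (\<lambda>i. - cmod (x $ i)) [0..<dim_vec x]))"

definition best_sparse :: "nat \<Rightarrow> complex vec \<Rightarrow> complex vec" where
  "best_sparse r x = restrict_vec x (largest_indices r x)"

definition column_submatrix :: "complex mat \<Rightarrow> nat set \<Rightarrow> complex mat" where
  "column_submatrix A T = submatrix A UNIV T"

(* (A* A)^(-1) A*, meaningful only if A has full column rank. *)
definition pseudo_inverse :: "complex mat \<Rightarrow> complex mat" where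
  "pseudo_inverse A = the (mat_inverse (mat_adjoint A * A)) * mat_adjoint A"

(* The vector b of length n with b|_T = w and b = 0 off T. Here w, an element of C^T, is listed
   in increasing order of the indices in T, as are the columns of column_submatrix A T. *)
definition extend_vec :: "nat \<Rightarrow> nat set \<Rightarrow> complex vec \<Rightarrow> complex vec" where
  "extend_vec n T w = vec n (\<lambda>i. if i \<in> T then w $ card {j \<in> T. j < i} else 0)"

(* The state is the pair (a, v) of the current approximation and the current residual. *)
definition cosamp_step ::
  "complex mat \<Rightarrow> complex vec \<Rightarrow> nat \<Rightarrow> complex vec \<times> complex vec \<Rightarrow> complex vec \<times> complex vec" where
  "cosamp_step A u s = (\<lambda>(a, v).
     let y = mat_adjoint A *\<^sub>v v;
         \<Omega> = supp_vec (best_sparse (2 * s) y);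
         T = \<Omega> \<union> supp_vec a;
         b = extend_vec (dim_col A) T (pseudo_inverse (column_submatrix A T) *\<^sub>v u);
         a' = best_sparse s b
     in (a', u - A *\<^sub>v a'))"

definition cosamp_state ::
  "complex mat \<Rightarrow> complex vec \<Rightarrow> nat \<Rightarrow> nat \<Rightarrow> complex vec \<times> complex vec" where
  "cosamp_state A u s k = (cosamp_step A u s ^^ k) (0\<^sub>v (dim_col A), u)"

definition cosamp :: "complex mat \<Rightarrow> complex vec \<Rightarrow> nat \<Rightarrow> nat \<Rightarrow> complex vec" where
  "cosamp A u s k = fst (cosamp_state A u s k)"

end

(* Everything follows from one estimate: if p and q are supported in a common set of at most r
   indices, then polarization turns the restricted isometry property into
   |Re <A p, A q> - Re <p, q>| \<le> \<delta> |p| |q|. Real parts suffice because the test vectors are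
   chosen to make the relevant Hermitian products real.
   Let d = x - a^k with x s-sparse. Testing y = A* (A d + e) against its restriction to the selected
   indices outside supp d, and against the restriction of d to the missed indices, bounds the part
   of d missed by the selection by 2 (\<delta> |d| + sqrt (1 + \<delta>) |e|). Testing the normal equations
   against (x - b) restricted to T gives (1 - \<delta>) |x - b| \<le> |x off T| + sqrt (1 + \<delta>) |e|, and
   pruning b to s entries at most doubles the error. With \<delta> = 0.1 the factor is 0.4/0.9 < 1/2.
   For general x, the tail x - x_s is moved into the noise; cutting it into blocks of decreasing
   magnitude bounds its image by sqrt (1 + \<delta>) (|x - x_s|_2 + |x - x_s|_1 / sqrt s). *)

theory Submission
  imports Defs "HOL-Analysis.Inner_Product"
begin

section \<open>Euclidean geometry of complex vectors, regarded as a real inner product space\<close>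

section \<open>The real inner product on complex vectors\<close>

text \<open>On complex numbers \<open>inner z w\<close> is Re (z cnj w), so this is the real part of
  the Hermitian product. It is symmetric and real bilinear, so polarization takes its real
  form.\<close>

definition rinner :: "complex vec \<Rightarrow> complex vec \<Rightarrow> real" where
  "rinner x y = (\<Sum>i<dim_vec x. inner (x $ i) (y $ i))"

lemma norm2_vec_nonneg [simp]: "0 \<le> norm2_vec x"
  by (simp add: norm2_vec_def)

lemma norm2_vec_power2: "(norm2_vec x)\<^sup>2 = rinner x x"
  by (simp add: norm2_vec_def rinner_def L2_set_def sum_nonneg power2_norm_eq_inner)

lemma norm2_vec_eq_0:
  assumes "x \<in> carrier_vec n" "norm2_vec x = 0"
  shows "x = 0\<^sub>v n"
  using assms by (intro eq_vecI) (auto simp: norm2_vec_def L2_set_eq_0_iff)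

lemma norm2_vec_zero [simp]: "norm2_vec (0\<^sub>v n) = 0"
  by (auto simp: norm2_vec_def intro!: L2_set_0')

lemma rinner_commute:
  assumes "x \<in> carrier_vec n" "y \<in> carrier_vec n"
  shows "rinner x y = rinner y x"
  using assms by (simp add: rinner_def inner_commute)

lemma rinner_add_left:
  assumes "x \<in> carrier_vec n" "y \<in> carrier_vec n" "z \<in> carrier_vec n"
  shows "rinner (x + y) z = rinner x z + rinner y z"
  using assms by (simp add: rinner_def inner_add_left sum.distrib)

lemma rinner_diff_left:
  assumes "x \<in> carrier_vec n" "y \<in> carrier_vec n" "z \<in> carrier_vec n"
  shows "rinner (x - y) z = rinner x z - rinner y z"
  using assms by (simp add: rinner_def inner_diff_left sum_subtractf)

lemma rinner_add_right:
  assumes "x \<in> carrier_vec n" "y \<in> carrier_vec n" "z \<in> carrier_vec n"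
  shows "rinner x (y + z) = rinner x y + rinner x z"
  using assms by (simp add: rinner_def inner_add_right sum.distrib)

lemma rinner_diff_right:
  assumes "x \<in> carrier_vec n" "y \<in> carrier_vec n" "z \<in> carrier_vec n"
  shows "rinner x (y - z) = rinner x y - rinner x z"
  using assms by (simp add: rinner_def inner_diff_right sum_subtractf)

lemma rinner_smult_left:
  assumes "x \<in> carrier_vec n" "y \<in> carrier_vec n"
  shows "rinner (complex_of_real c \<cdot>\<^sub>v x) y = c * rinner x y"
  using assms by (simp add: rinner_def inner_complex_def sum_distrib_left algebra_simps)

lemma rinner_smult_right:
  assumes "x \<in> carrier_vec n" "y \<in> carrier_vec n"
  shows "rinner x (complex_of_real c \<cdot>\<^sub>v y) = c * rinner x y"
  using assms by (simp add: rinner_def inner_complex_def sum_distrib_left algebra_simps)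

lemma norm2_vec_add_power2:
  assumes "x \<in> carrier_vec n" "y \<in> carrier_vec n"
  shows "(norm2_vec (x + y))\<^sup>2 = (norm2_vec x)\<^sup>2 + 2 * rinner x y + (norm2_vec y)\<^sup>2"
  using assms rinner_commute[OF assms] add_carrier_vec[OF assms]
  by (simp add: norm2_vec_power2 rinner_add_left[of _ n] rinner_add_right[of _ n])

lemma norm2_vec_diff_power2:
  assumes "x \<in> carrier_vec n" "y \<in> carrier_vec n"
  shows "(norm2_vec (x - y))\<^sup>2 = (norm2_vec x)\<^sup>2 - 2 * rinner x y + (norm2_vec y)\<^sup>2"
  using assms rinner_commute[OF assms] minus_carrier_vec[OF assms]
  by (simp add: norm2_vec_power2 rinner_diff_left[of _ n] rinner_diff_right[of _ n])

lemma norm2_vec_smult: "norm2_vec (c \<cdot>\<^sub>v x) = cmod c * norm2_vec x"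
  by (simp add: norm2_vec_def norm_mult L2_set_right_distrib cong: L2_set_cong_simp)

text \<open>Cauchy-Schwarz twice: in the complex plane for each coordinate, then for the sums of
  moduli.\<close>

lemma abs_rinner_le:
  assumes "x \<in> carrier_vec n" "y \<in> carrier_vec n"
  shows "\<bar>rinner x y\<bar> \<le> norm2_vec x * norm2_vec y"
proof -
  have "\<bar>rinner x y\<bar> \<le> (\<Sum>i<n. \<bar>inner (x $ i) (y $ i)\<bar>)"
    using assms by (auto simp: rinner_def)
  also have "\<dots> \<le> (\<Sum>i<n. \<bar>cmod (x $ i)\<bar> * \<bar>cmod (y $ i)\<bar>)"
    by (intro sum_mono) (simp add: Cauchy_Schwarz_ineq2)
  also have "\<dots> \<le> norm2_vec x * norm2_vec y"
    using assms L2_set_mult_ineq[of "\<lambda>i. cmod (x $ i)" "\<lambda>i. cmod (y $ i)" "{..<n}"]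
    by (simp add: norm2_vec_def)
  finally show ?thesis .
qed

lemma norm2_vec_triangle:
  assumes "x \<in> carrier_vec n" "y \<in> carrier_vec n"
  shows "norm2_vec (x + y) \<le> norm2_vec x + norm2_vec y"
proof -
  have "norm2_vec (x + y) \<le> L2_set (\<lambda>i. cmod (x $ i) + cmod (y $ i)) {..<n}"
    unfolding norm2_vec_def using assms by (auto intro!: L2_set_mono norm_triangle_ineq)
  also have "\<dots> \<le> norm2_vec x + norm2_vec y"
    using assms L2_set_triangle_ineq by (simp add: norm2_vec_def)
  finally show ?thesis .
qed

lemma norm2_vec_minus_commute:
  assumes "x \<in> carrier_vec n" "y \<in> carrier_vec n"
  shows "norm2_vec (x - y) = norm2_vec (y - x)"
  using assms by (simp add: norm2_vec_def norm_minus_commute cong: L2_set_cong_simp)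

lemma norm2_vec_triangle_minus:
  assumes "x \<in> carrier_vec n" "y \<in> carrier_vec n" "z \<in> carrier_vec n"
  shows "norm2_vec (x - z) \<le> norm2_vec (x - y) + norm2_vec (y - z)"
proof -
  have "x - z = (x - y) + (y - z)"
    using assms by (intro eq_vecI) auto
  then show ?thesis
    using norm2_vec_triangle[of "x - y" n "y - z"] assms by simp
qed

text \<open>Under \<open>inner\<close>, a complex factor moves to the other argument as its
  conjugate; exchanging the two sums then gives the adjoint.\<close>

lemma rinner_mat_adjoint:
  assumes "A \<in> carrier_mat m n" "z \<in> carrier_vec n" "v \<in> carrier_vec m"
  shows "rinner (A *\<^sub>v z) v = rinner z (mat_adjoint A *\<^sub>v v)"
proof -
  have [simp]: "dim_row A = m" "dim_col A = n" "dim_vec z = n" "dim_vec v = m"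
    using assms by auto
  have adj: "(mat_adjoint A *\<^sub>v v) $ j = (\<Sum>i<m. cnj (A $$ (i, j)) * v $ i)" if "j < n" for j
    using that by (simp add: mat_adjoint_def scalar_prod_def row_def mat_of_rows_def
        atLeast0LessThan conjugate_complex_def)
  have app: "(A *\<^sub>v z) $ i = (\<Sum>j<n. A $$ (i, j) * z $ j)" if "i < m" for i
    using that by (simp add: scalar_prod_def atLeast0LessThan)
  have "rinner (A *\<^sub>v z) v = (\<Sum>i<m. \<Sum>j<n. inner (A $$ (i, j) * z $ j) (v $ i))"
    by (simp add: rinner_def app inner_sum_left del: index_mult_mat_vec)
  also have "\<dots> = (\<Sum>j<n. \<Sum>i<m. inner (A $$ (i, j) * z $ j) (v $ i))"
    by (rule sum.swap)
  also have "\<dots> = (\<Sum>j<n. \<Sum>i<m. inner (z $ j) (cnj (A $$ (i, j)) * v $ i))"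
    by (intro sum.cong refl) (simp add: inner_complex_def algebra_simps)
  also have "\<dots> = rinner z (mat_adjoint A *\<^sub>v v)"
    by (simp add: rinner_def adj inner_sum_right del: index_mult_mat_vec)
  finally show ?thesis .
qed

section \<open>Supports and restriction to index sets\<close>

section \<open>Restriction and best sparse approximation\<close>

lemma supp_vec_subset: "x \<in> carrier_vec n \<Longrightarrow> supp_vec x \<subseteq> {..<n}"
  by (auto simp: supp_vec_def)

lemma finite_supp_vec [simp]: "finite (supp_vec x)"
  by (simp add: supp_vec_def)

lemma supp_vec_diff:
  assumes "x \<in> carrier_vec n" "y \<in> carrier_vec n"
  shows "supp_vec (x - y) \<subseteq> supp_vec x \<union> supp_vec y"
  using assms by (auto simp: supp_vec_def)

lemma supp_vec_add:
  assumes "x \<in> carrier_vec n" "y \<in> carrier_vec n"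
  shows "supp_vec (x + y) \<subseteq> supp_vec x \<union> supp_vec y"
  using assms by (auto simp: supp_vec_def)

lemma supp_vec_smult: "supp_vec (c \<cdot>\<^sub>v x) \<subseteq> supp_vec x"
  by (auto simp: supp_vec_def)

lemma restrict_vec_carrier [simp]: "restrict_vec x T \<in> carrier_vec n \<longleftrightarrow> x \<in> carrier_vec n"
  by (metis carrier_vecD carrier_vecI dim_vec restrict_vec_def)

lemma dim_restrict_vec [simp]: "dim_vec (restrict_vec x T) = dim_vec x"
  by (simp add: restrict_vec_def)

lemma index_restrict_vec [simp]:
  "i < dim_vec x \<Longrightarrow> restrict_vec x T $ i = (if i \<in> T then x $ i else 0)"
  by (simp add: restrict_vec_def)

lemma supp_restrict_vec: "supp_vec (restrict_vec x T) = supp_vec x \<inter> T"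
  unfolding supp_vec_def restrict_vec_def by (auto split: if_splits)

text \<open>This is why restrictions serve as test vectors: pairing a vector with its own
  restriction produces a squared norm.\<close>

lemma rinner_restrict_vec_self:
  "rinner (restrict_vec x T) x = (norm2_vec (restrict_vec x T))\<^sup>2"
  unfolding norm2_vec_power2 rinner_def by (intro sum.cong) auto

lemma norm2_restrict_vec_power2:
  "(norm2_vec (restrict_vec x T))\<^sup>2 = (\<Sum>i\<in>{..<dim_vec x} \<inter> T. (cmod (x $ i))\<^sup>2)"
proof -
  have "(norm2_vec (restrict_vec x T))\<^sup>2 = (\<Sum>i<dim_vec x. if i \<in> T then (cmod (x $ i))\<^sup>2 else 0)"
    unfolding norm2_vec_def L2_set_def by (auto simp: sum_nonneg intro!: sum.cong)
  then show ?thesis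
    by (simp add: sum.If_cases)
qed

text \<open>Indices outside the support contribute nothing, so the inclusion is asked for only
  inside it.\<close>

lemma norm2_restrict_vec_mono:
  assumes "supp_vec x \<inter> S \<subseteq> T"
  shows "norm2_vec (restrict_vec x S) \<le> norm2_vec (restrict_vec x T)"
  unfolding norm2_vec_def using assms by (auto intro!: L2_set_mono simp: supp_vec_def)

lemma norm2_restrict_vec_le: "norm2_vec (restrict_vec x S) \<le> norm2_vec x"
  unfolding norm2_vec_def by (auto intro!: L2_set_mono)

lemma restrict_vec_split:
  "x = restrict_vec x T + restrict_vec x (- T)"
  by (intro eq_vecI) auto

lemma minus_restrict_vec: "x - restrict_vec x T = restrict_vec x (- T)"
  by (intro eq_vecI) auto

section \<open>Selection of the largest entries and optimality of pruning\<close>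

lemma largest_indices_subset: "largest_indices r x \<subseteq> {..<dim_vec x}"
  unfolding largest_indices_def using set_take_subset by fastforce

lemma finite_largest_indices [simp]: "finite (largest_indices r x)"
  by (simp add: largest_indices_def)

lemma card_largest_indices: "card (largest_indices r x) = min r (dim_vec x)"
  by (simp add: largest_indices_def distinct_card min.commute)

text \<open>The sorted list is cut into \<open>take r\<close> and \<open>drop r\<close>; every key
  in the first piece is at most every key in the second, and the keys are negated
  magnitudes.\<close>

lemma largest_indices_ge:
  assumes "i \<in> largest_indices r x" "j < dim_vec x" "j \<notin> largest_indices r x"
  shows "cmod (x $ j) \<le> cmod (x $ i)"
proof -
  define f where "f = (\<lambda>i. - cmod (x $ i))"
  define l where "l = sort_key f [0..<dim_vec x]"
  have l: "sorted (map f (take r l @ drop r l))"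
    by (simp add: l_def)
  have "j \<in> set (take r l @ drop r l)"
    using assms(2) by (simp add: l_def)
  then have "j \<in> set (drop r l)"
    using assms(3) unfolding largest_indices_def f_def[symmetric] l_def[symmetric] by (metis Un_iff set_append)
  moreover have "i \<in> set (take r l)"
    using assms(1) unfolding largest_indices_def f_def[symmetric] l_def[symmetric] .
  ultimately have "f i \<le> f j"
    using l unfolding map_append sorted_append by auto
  then show ?thesis by (simp add: f_def)
qed

lemma best_sparse_carrier [simp]: "best_sparse r x \<in> carrier_vec n \<longleftrightarrow> x \<in> carrier_vec n"
  by (simp add: best_sparse_def)

lemma supp_best_sparse: "supp_vec (best_sparse r x) = supp_vec x \<inter> largest_indices r x"
  by (simp add: best_sparse_def supp_restrict_vec)

lemma card_supp_best_sparse: "card (supp_vec (best_sparse r x)) \<le> r"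
proof -
  have "card (supp_vec (best_sparse r x)) \<le> card (largest_indices r x)"
    by (intro card_mono) (auto simp: supp_best_sparse)
  then show ?thesis by (simp add: card_largest_indices)
qed

text \<open>An exchange argument: \<open>L - S\<close> has at least as many indices as
  \<open>S - L\<close>, and each of its entries is at least as large as the largest entry on
  \<open>S - L\<close>.\<close>

lemma largest_indices_dominate:
  assumes S: "S \<subseteq> {..<dim_vec x}" "card S \<le> r"
  defines "L \<equiv> largest_indices r x"
  shows "(\<Sum>i\<in>S - L. (cmod (x $ i))\<^sup>2) \<le> (\<Sum>i\<in>L - S. (cmod (x $ i))\<^sup>2)"
proof (cases "S - L = {}")
  case False
  have fin: "finite S" "finite L"
    using S(1) finite_subset by (auto simp: L_def)
  define M where "M = Max ((\<lambda>i. (cmod (x $ i))\<^sup>2) ` (S - L))"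
  have "M \<in> (\<lambda>i. (cmod (x $ i))\<^sup>2) ` (S - L)"
    unfolding M_def using False fin by (intro Max_in) auto
  then obtain j where j: "j \<in> S" "j \<notin> L" "M = (cmod (x $ j))\<^sup>2"
    by auto
  \<comment> \<open>\<open>L\<close> has \<open>min r (dim_vec x)\<close> elements, and
    \<open>card S\<close> is bounded by both numbers.\<close>
  have "card S \<le> card L"
    using S card_mono[OF _ S(1)] by (simp add: L_def card_largest_indices)
  then have card: "card (S - L) \<le> card (L - S)"
    using fin by (simp add: card_Diff_subset_Int Int_commute)
  have "(\<Sum>i\<in>S - L. (cmod (x $ i))\<^sup>2) \<le> card (S - L) * M"
    using fin by (intro sum_bounded_above) (auto simp: M_def)
  also have "\<dots> \<le> card (L - S) * M"
    using card j by (intro mult_right_mono) auto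
  also have "\<dots> \<le> (\<Sum>i\<in>L - S. (cmod (x $ i))\<^sup>2)"
  proof (intro sum_bounded_below)
    fix i assume "i \<in> L - S"
    then show "M \<le> (cmod (x $ i))\<^sup>2"
      using largest_indices_ge[of i r x j] j S(1) by (auto simp: L_def intro!: power_mono)
  qed
  finally show ?thesis .
next
  case True
  show ?thesis
    unfolding True by (simp add: sum_nonneg)
qed

lemma norm2_restrict_largest_indices:
  assumes "S \<subseteq> {..<dim_vec x}" "card S \<le> r"
  shows "norm2_vec (restrict_vec x (S - largest_indices r x))
           \<le> norm2_vec (restrict_vec x (largest_indices r x - S))"
proof (rule power2_le_imp_le)
  have "{..<dim_vec x} \<inter> (S - largest_indices r x) = S - largest_indices r x"
    "{..<dim_vec x} \<inter> (largest_indices r x - S) = largest_indices r x - S"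
    using assms(1) largest_indices_subset[of r x] by auto
  then show "(norm2_vec (restrict_vec x (S - largest_indices r x)))\<^sup>2
           \<le> (norm2_vec (restrict_vec x (largest_indices r x - S)))\<^sup>2"
    using largest_indices_dominate[OF assms] by (simp add: norm2_restrict_vec_power2)
qed simp

text \<open>The squared pruning error lives off \<open>L\<close>. Its part on \<open>S - L\<close>
  is exchanged for the larger mass on \<open>L - S\<close>, which gives the mass of \<open>x\<close>
  off the support \<open>S\<close> of the competitor.\<close>

lemma best_sparse_optimal:
  assumes x: "x \<in> carrier_vec n" and z: "z \<in> carrier_vec n" "card (supp_vec z) \<le> r"
  shows "norm2_vec (x - best_sparse r x) \<le> norm2_vec (x - z)"
proof (rule power2_le_imp_le)
  define L where "L = largest_indices r x"
  define S where "S = supp_vec z"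
  define f where "f = (\<lambda>i. (cmod (x $ i))\<^sup>2)"
  have sub: "L \<subseteq> {..<n}" "S \<subseteq> {..<n}"
    using x supp_vec_subset[OF z(1)] largest_indices_subset[of r x] by (auto simp: L_def S_def)
  have "(norm2_vec (x - best_sparse r x))\<^sup>2 = sum f ({..<n} \<inter> - L)"
    using x by (simp add: best_sparse_def minus_restrict_vec norm2_restrict_vec_power2 L_def f_def)
  also have "{..<n} \<inter> - L = ({..<n} - L - S) \<union> (S - L)"
    using sub by auto
  also have "sum f \<dots> = sum f ({..<n} - L - S) + sum f (S - L)"
    using finite_subset[OF sub(2)] by (intro sum.union_disjoint) auto
  also have "\<dots> \<le> sum f ({..<n} - L - S) + sum f (L - S)"
    using largest_indices_dominate[of S x r] x z sub by (simp add: L_def S_def f_def)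
  also have "\<dots> = sum f (({..<n} - L - S) \<union> (L - S))"
    using finite_subset[OF sub(1)] by (intro sum.union_disjoint[symmetric]) auto
  also have "({..<n} - L - S) \<union> (L - S) = {..<n} \<inter> - S"
    using sub by auto
  also have "sum f \<dots> = (norm2_vec (restrict_vec x (- S)))\<^sup>2"
    using x by (simp add: norm2_restrict_vec_power2 f_def)
  \<comment> \<open>Off \<open>S\<close> the competitor vanishes, so there \<open>x - z\<close>
    agrees with \<open>x\<close>.\<close>
  also have "\<dots> \<le> (norm2_vec (x - z))\<^sup>2"
  proof (rule power_mono)
    show "norm2_vec (restrict_vec x (- S)) \<le> norm2_vec (x - z)"
      unfolding norm2_vec_def using x z by (auto intro!: L2_set_mono simp: S_def supp_vec_def)
  qed simp
  finally show "(norm2_vec (x - best_sparse r x))\<^sup>2 \<le> (norm2_vec (x - z))\<^sup>2" .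
qed simp

section \<open>Coordinates on a column subset, and the normal equations\<close>

section \<open>Least squares on a set of columns\<close>

text \<open>The rank map has left inverse \<open>pick T\<close>, and its image lies in a set of the
  same finite size. Ranks are the column positions in the submatrix.\<close>

lemma bij_betw_card_less:
  fixes T :: "nat set"
  assumes "finite T"
  shows "bij_betw (\<lambda>j. card {i \<in> T. i < j}) T {..<card T}"
proof -
  have inj: "inj_on (\<lambda>j. card {i \<in> T. i < j}) T"
    by (rule inj_on_inverseI[of _ "pick T"]) (simp add: pick_card_in_set)
  have "card {i \<in> T. i < j} < card T" if "j \<in> T" for j
    using assms that by (intro psubset_card_mono) auto
  then have "(\<lambda>j. card {i \<in> T. i < j}) ` T = {..<card T}"
    using inj by (intro card_subset_eq) (auto simp: card_image)
  with inj show ?thesis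
    by (simp add: bij_betw_def)
qed

lemma column_submatrix_carrier:
  assumes "A \<in> carrier_mat m n" "T \<subseteq> {..<n}"
  shows "column_submatrix A T \<in> carrier_mat m (card T)"
proof -
  have "{j. j < n \<and> j \<in> T} = T"
    using assms(2) by auto
  then show ?thesis
    using carrier_matD[OF assms(1)]
    by (intro carrier_matI) (simp_all add: column_submatrix_def dim_submatrix)
qed

lemma extend_vec_carrier [simp]: "extend_vec n T w \<in> carrier_vec n"
  by (simp add: extend_vec_def)

lemma supp_extend_vec: "supp_vec (extend_vec n T w) \<subseteq> T"
  by (auto simp: supp_vec_def extend_vec_def split: if_splits)

text \<open>Only columns in \<open>T\<close> contribute, and the rank bijection reindexes that sum
  by the columns of the submatrix.\<close>

lemma mult_mat_extend_vec:
  assumes A: "A \<in> carrier_mat m n" and T: "T \<subseteq> {..<n}" and w: "w \<in> carrier_vec (card T)"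
  shows "A *\<^sub>v extend_vec n T w = column_submatrix A T *\<^sub>v w"
proof (rule eq_vecI)
  let ?B = "column_submatrix A T" and ?rk = "\<lambda>j. card {i \<in> T. i < j}"
  have B: "?B \<in> carrier_mat m (card T)"
    by (rule column_submatrix_carrier[OF A T])
  have fin: "finite T"
    using T finite_subset by blast
  show "dim_vec (A *\<^sub>v extend_vec n T w) = dim_vec (?B *\<^sub>v w)"
    using A B by simp
  fix i assume "i < dim_vec (?B *\<^sub>v w)"
  then have i: "i < m" using B by simp
  have "(A *\<^sub>v extend_vec n T w) $ i = (\<Sum>j<n. A $$ (i, j) * (if j \<in> T then w $ ?rk j else 0))"
    using A i by (simp add: scalar_prod_def extend_vec_def atLeast0LessThan)
  also have "\<dots> = (\<Sum>j<n. if j \<in> T then A $$ (i, j) * w $ ?rk j else 0)"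
    by (intro sum.cong) auto
  also have "\<dots> = (\<Sum>j\<in>T. A $$ (i, j) * w $ ?rk j)"
    using T by (simp add: sum.If_cases Int_absorb1)
  also have "\<dots> = (\<Sum>j\<in>T. ?B $$ (i, ?rk j) * w $ ?rk j)"
  proof (intro sum.cong refl)
    fix j assume "j \<in> T"
    then show "A $$ (i, j) * w $ ?rk j = ?B $$ (i, ?rk j) * w $ ?rk j"
      using submatrix_index_card[of i A j UNIV T] A T i by (auto simp: column_submatrix_def)
  qed
  also have "\<dots> = (\<Sum>k<card T. ?B $$ (i, k) * w $ k)"
    using sum.reindex_bij_betw[OF bij_betw_card_less[OF fin], of "\<lambda>k. ?B $$ (i, k) * w $ k"] .
  also have "\<dots> = (?B *\<^sub>v w) $ i"
    using B w i by (simp add: scalar_prod_def atLeast0LessThan)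
  finally show "(A *\<^sub>v extend_vec n T w) $ i = (?B *\<^sub>v w) $ i" .
qed

text \<open>Each position of \<open>w\<close> is the rank of some element of \<open>T\<close>, so no
  entry of \<open>w\<close> is lost in the extension. This carries injectivity over to the column
  submatrix.\<close>

lemma extend_vec_eq_0:
  assumes T: "T \<subseteq> {..<n}" and w: "w \<in> carrier_vec (card T)" and "extend_vec n T w = 0\<^sub>v n"
  shows "w = 0\<^sub>v (card T)"
proof (rule eq_vecI)
  fix k assume k: "k < dim_vec (0\<^sub>v (card T))"
  moreover have "(\<lambda>j. card {i \<in> T. i < j}) ` T = {..<card T}"
    using bij_betw_card_less[of T] T finite_subset unfolding bij_betw_def by blast
  ultimately have "k \<in> (\<lambda>j. card {i \<in> T. i < j}) ` T"
    by simp
  then obtain j where j: "j \<in> T" "k = card {i \<in> T. i < j}"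
    by blast
  then have "w $ k = extend_vec n T w $ j"
    using T by (auto simp: extend_vec_def)
  then show "w $ k = 0\<^sub>v (card T) $ k"
    using assms(3) j T k by auto
qed (use w in auto)

lemma extend_vec_pick:
  assumes "z \<in> carrier_vec n" "supp_vec z \<subseteq> T" "T \<subseteq> {..<n}"
  shows "extend_vec n T (vec (card T) (\<lambda>k. z $ pick T k)) = z"
proof (rule eq_vecI)
  fix i assume "i < dim_vec z"
  moreover have "card {j \<in> T. j < i} < card T" if "i \<in> T"
    using assms(3) that finite_subset by (intro psubset_card_mono) auto
  ultimately show "extend_vec n T (vec (card T) (\<lambda>k. z $ pick T k)) $ i = z $ i"
    using assms by (auto simp: extend_vec_def supp_vec_def pick_card_in_set)
qed (use assms in \<open>auto simp: extend_vec_def\<close>)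

lemma mat_adjoint_carrier [simp]:
  "A \<in> carrier_mat m n \<Longrightarrow> mat_adjoint A \<in> carrier_mat n m"
  by (auto simp: mat_adjoint_def)

text \<open>Injectivity makes the Gram matrix invertible, so the pseudo-inverse solves the normal
  equations and the residual is orthogonal to the range of \<open>B\<close>.\<close>

lemma pseudo_inverse_normal_equations:
  assumes B: "B \<in> carrier_mat m t" and u: "u \<in> carrier_vec m"
    and inj: "\<And>w. w \<in> carrier_vec t \<Longrightarrow> B *\<^sub>v w = 0\<^sub>v m \<Longrightarrow> w = 0\<^sub>v t"
  shows "pseudo_inverse B *\<^sub>v u \<in> carrier_vec t"
    and "w \<in> carrier_vec t \<Longrightarrow> rinner (B *\<^sub>v w) (u - B *\<^sub>v (pseudo_inverse B *\<^sub>v u)) = 0"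
proof -
  define G where "G = mat_adjoint B * B"
  have B': "mat_adjoint B \<in> carrier_mat t m" and G: "G \<in> carrier_mat t t"
    using B mult_carrier_mat[OF mat_adjoint_carrier[OF B] B] by (simp_all add: G_def)
  \<comment> \<open>A kernel vector \<open>w\<close> of \<open>G\<close> satisfies |B w|^2 = <w, G
    w> = 0, against injectivity.\<close>
  have "det G \<noteq> 0"
  proof
    assume "det G = 0"
    then obtain w where w: "w \<in> carrier_vec t" "w \<noteq> 0\<^sub>v t" "G *\<^sub>v w = 0\<^sub>v t"
      using det_0_iff_vec_prod_zero_field[OF G] by auto
    have Bw: "B *\<^sub>v w \<in> carrier_vec m"
      using B w by simp
    have "(norm2_vec (B *\<^sub>v w))\<^sup>2 = rinner w (mat_adjoint B *\<^sub>v (B *\<^sub>v w))"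
      unfolding norm2_vec_power2 by (rule rinner_mat_adjoint[OF B w(1) Bw])
    also have "mat_adjoint B *\<^sub>v (B *\<^sub>v w) = 0\<^sub>v t"
      using assoc_mult_mat_vec[OF B' B w(1)] w(3) by (simp add: G_def)
    also have "rinner w (0\<^sub>v t) = 0"
      using w(1) by (simp add: rinner_def)
    finally have "B *\<^sub>v w = 0\<^sub>v m"
      using norm2_vec_eq_0[OF Bw] by simp
    with inj w show False by blast
  qed
  then have "G \<in> Units (ring_mat TYPE(complex) t ())"
    by (rule det_non_zero_imp_unit[OF G])
  \<comment> \<open>Here \<open>the (mat_inverse G)\<close> in the pseudo-inverse gets a genuine
    value.\<close>
  then obtain C where C: "mat_inverse G = Some C"
    using mat_inverse(1)[OF G, where b = "()"] by (cases "mat_inverse G") auto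
  have GC: "G * C = 1\<^sub>m t" "C \<in> carrier_mat t t"
    using mat_inverse(2)[OF G C] by auto
  define w0 where "w0 = pseudo_inverse B *\<^sub>v u"
  have w0: "w0 = C *\<^sub>v (mat_adjoint B *\<^sub>v u)"
    using assoc_mult_mat_vec[OF GC(2) B' u] C
    by (simp add: w0_def pseudo_inverse_def G_def)
  have B'u: "mat_adjoint B *\<^sub>v u \<in> carrier_vec t"
    using B' u by simp
  show w0_carrier: "pseudo_inverse B *\<^sub>v u \<in> carrier_vec t"
    using GC B'u w0 by (simp add: w0_def)
  then have w0c: "w0 \<in> carrier_vec t"
    by (simp add: w0_def)
  have Gw0: "mat_adjoint B *\<^sub>v (B *\<^sub>v w0) = mat_adjoint B *\<^sub>v u"
  proof -
    have "mat_adjoint B *\<^sub>v (B *\<^sub>v w0) = G *\<^sub>v w0"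
      using assoc_mult_mat_vec[OF B' B w0c] by (simp add: G_def)
    also have "\<dots> = (G * C) *\<^sub>v (mat_adjoint B *\<^sub>v u)"
      using assoc_mult_mat_vec[OF G GC(2) B'u] by (simp add: w0)
    finally show ?thesis
      using GC(1) B'u by simp
  qed
  assume w: "w \<in> carrier_vec t"
  have "rinner (B *\<^sub>v w) (u - B *\<^sub>v w0) = rinner (B *\<^sub>v w) u - rinner (B *\<^sub>v w) (B *\<^sub>v w0)"
    using B u w w0c by (intro rinner_diff_right[of _ m]) auto
  also have "\<dots> = 0"
    using rinner_mat_adjoint[OF B w, of u] rinner_mat_adjoint[OF B w, of "B *\<^sub>v w0"] B u w0c Gw0
    by simp
  finally show "rinner (B *\<^sub>v w) (u - B *\<^sub>v (pseudo_inverse B *\<^sub>v u)) = 0"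
    by (simp add: w0_def)
qed

text \<open>Extension by zero identifies vectors of length \<open>card T\<close> with vectors
  supported in \<open>T\<close>, so orthogonality passes from the submatrix to \<open>A\<close>
  itself.\<close>

lemma extend_pseudo_inverse_normal_equations:
  assumes A: "A \<in> carrier_mat m n" and T: "T \<subseteq> {..<n}" and u: "u \<in> carrier_vec m"
    and inj: "\<And>z. z \<in> carrier_vec n \<Longrightarrow> supp_vec z \<subseteq> T \<Longrightarrow> A *\<^sub>v z = 0\<^sub>v m \<Longrightarrow> z = 0\<^sub>v n"
    and z: "z \<in> carrier_vec n" "supp_vec z \<subseteq> T"
  shows "rinner (A *\<^sub>v z)
    (u - A *\<^sub>v extend_vec n T (pseudo_inverse (column_submatrix A T) *\<^sub>v u)) = 0"
proof -
  let ?B = "column_submatrix A T"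
  have B: "?B \<in> carrier_mat m (card T)"
    by (rule column_submatrix_carrier[OF A T])
  have injB: "w = 0\<^sub>v (card T)" if "w \<in> carrier_vec (card T)" "?B *\<^sub>v w = 0\<^sub>v m" for w
    using that inj[of "extend_vec n T w"] extend_vec_eq_0[OF T] mult_mat_extend_vec[OF A T]
    by (simp add: supp_extend_vec)
  define w where "w = vec (card T) (\<lambda>k. z $ pick T k)"
  have "z = extend_vec n T w"
    using extend_vec_pick[OF z T] by (simp add: w_def)
  moreover have "w \<in> carrier_vec (card T)"
    by (simp add: w_def)
  ultimately show ?thesis
    using pseudo_inverse_normal_equations[OF B u injB] mult_mat_extend_vec[OF A T] by simp
qed

section \<open>Polarized near isometry and the error estimates for one iteration\<close>

section \<open>Consequences of the restricted isometry property\<close>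

text \<open>For positive \<open>a\<close>, cancel \<open>a\<close>; otherwise \<open>b\<close> is
  already at least \<open>a\<close>. Every test-vector argument below ends this way.\<close>

lemma le_if_power2_le_mult:
  fixes a b :: real
  assumes "a\<^sup>2 \<le> a * b" "0 \<le> b"
  shows "a \<le> b"
  using assms by (metis mult_le_cancel_left_pos not_le order_trans less_imp_le power2_eq_square)

lemma rinner_restrict_vec_left:
  assumes "x \<in> carrier_vec n" "y \<in> carrier_vec n"
  shows "rinner (restrict_vec x T) y = rinner (restrict_vec x T) (restrict_vec y T)"
  unfolding rinner_def using assms by (intro sum.cong) auto

text \<open>Any admissible nonnegative \<delta> is allowed instead of the least one, so a numerical
  bound can be inserted directly. Nonnegativity is assumed because the two inequalities do not force
  it when \<open>n\<close> or \<open>r\<close> is 0.\<close>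

locale restricted_isometry =
  fixes A :: "complex mat" and m n r :: nat and \<delta> :: real
  assumes mat_carrier: "A \<in> carrier_mat m n"
    and \<delta>_nonneg: "0 \<le> \<delta>"
    and lower: "x \<in> carrier_vec n \<Longrightarrow> card (supp_vec x) \<le> r \<Longrightarrow>
      (1 - \<delta>) * (norm2_vec x)\<^sup>2 \<le> (norm2_vec (A *\<^sub>v x))\<^sup>2"
    and upper: "x \<in> carrier_vec n \<Longrightarrow> card (supp_vec x) \<le> r \<Longrightarrow>
      (norm2_vec (A *\<^sub>v x))\<^sup>2 \<le> (1 + \<delta>) * (norm2_vec x)\<^sup>2"
begin

lemma mult_carrier [simp]: "A *\<^sub>v x \<in> carrier_vec m"
  using mat_carrier by (intro carrier_vecI) simp

lemma mult_add: "x \<in> carrier_vec n \<Longrightarrow> y \<in> carrier_vec n \<Longrightarrow> A *\<^sub>v (x + y) = A *\<^sub>v x + A *\<^sub>v y"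
  using mat_carrier by (rule mult_add_distrib_mat_vec)

lemma mult_diff: "x \<in> carrier_vec n \<Longrightarrow> y \<in> carrier_vec n \<Longrightarrow> A *\<^sub>v (x - y) = A *\<^sub>v x - A *\<^sub>v y"
  using mat_carrier by (rule mult_minus_distrib_mat_vec)

lemma mult_smult: "x \<in> carrier_vec n \<Longrightarrow> A *\<^sub>v (c \<cdot>\<^sub>v x) = c \<cdot>\<^sub>v (A *\<^sub>v x)"
  using mat_carrier by (rule mult_mat_vec)

lemma norm2_mult_le:
  assumes "x \<in> carrier_vec n" "card (supp_vec x) \<le> r"
  shows "norm2_vec (A *\<^sub>v x) \<le> sqrt (1 + \<delta>) * norm2_vec x"
  using real_le_rsqrt[OF upper[OF assms]] by (simp add: real_sqrt_mult)

lemma inj_on_sparse: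
  assumes "\<delta> < 1" "x \<in> carrier_vec n" "card (supp_vec x) \<le> r" "A *\<^sub>v x = 0\<^sub>v m"
  shows "x = 0\<^sub>v n"
proof -
  have "(1 - \<delta>) * (norm2_vec x)\<^sup>2 \<le> 0"
    using lower[OF assms(2,3)] assms(4) by simp
  then show ?thesis
    using assms(1) norm2_vec_eq_0[OF assms(2)] by (simp add: mult_le_0_iff)
qed

text \<open>Subtract the lower bound for \<open>p - q\<close> from the upper bound for
  \<open>p + q\<close>. The left side is four times the wanted difference, and the parallelogram law
  turns the right side into twice \<delta> times the sum of squares.\<close>

lemma parallelogram_bound:
  assumes p: "p \<in> carrier_vec n" "supp_vec p \<subseteq> T" and q: "q \<in> carrier_vec n" "supp_vec q \<subseteq> T"
    and T: "finite T" "card T \<le> r"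
  shows "rinner (A *\<^sub>v p) (A *\<^sub>v q) - rinner p q \<le> \<delta> / 2 * ((norm2_vec p)\<^sup>2 + (norm2_vec q)\<^sup>2)"
proof -
  have "supp_vec (p + q) \<subseteq> T" "supp_vec (p - q) \<subseteq> T"
    using p q supp_vec_add[of p n q] supp_vec_diff[of p n q] by auto
  then have "card (supp_vec (p + q)) \<le> r" "card (supp_vec (p - q)) \<le> r"
    using T card_mono le_trans by metis+
  then have "(norm2_vec (A *\<^sub>v (p + q)))\<^sup>2 \<le> (1 + \<delta>) * (norm2_vec (p + q))\<^sup>2"
    "(1 - \<delta>) * (norm2_vec (p - q))\<^sup>2 \<le> (norm2_vec (A *\<^sub>v (p - q)))\<^sup>2"
    using p q by (simp_all add: upper lower)
  then have "((norm2_vec (A *\<^sub>v p + A *\<^sub>v q))\<^sup>2 - (norm2_vec (A *\<^sub>v p - A *\<^sub>v q))\<^sup>2)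
      - ((norm2_vec (p + q))\<^sup>2 - (norm2_vec (p - q))\<^sup>2)
      \<le> \<delta> * ((norm2_vec (p + q))\<^sup>2 + (norm2_vec (p - q))\<^sup>2)"
    using mult_add[OF p(1) q(1)] mult_diff[OF p(1) q(1)] by (simp add: algebra_simps)
  then show ?thesis
    unfolding norm2_vec_add_power2[OF p(1) q(1)] norm2_vec_diff_power2[OF p(1) q(1)]
      norm2_vec_add_power2[OF mult_carrier mult_carrier] norm2_vec_diff_power2[OF mult_carrier mult_carrier]
    by (simp add: algebra_simps)
qed

text \<open>Rescaling both vectors to the common norm |p| |q| turns the mean of squares in the
  polarized bound into a product.\<close>

lemma near_isometry_upper:
  assumes p: "p \<in> carrier_vec n" "supp_vec p \<subseteq> T" and q: "q \<in> carrier_vec n" "supp_vec q \<subseteq> T"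
    and T: "finite T" "card T \<le> r"
  shows "rinner (A *\<^sub>v p) (A *\<^sub>v q) - rinner p q \<le> \<delta> * norm2_vec p * norm2_vec q"
proof (cases "norm2_vec p = 0 \<or> norm2_vec q = 0")
  case True
  \<comment> \<open>A vector of norm zero cannot be rescaled, but the upper isometry bound makes its
    image vanish, so both products are zero.\<close>
  have "norm2_vec (A *\<^sub>v p) = 0 \<or> norm2_vec (A *\<^sub>v q) = 0"
    using True norm2_mult_le[OF p(1)] norm2_mult_le[OF q(1)] p(2) q(2) T norm2_vec_nonneg
    by (metis card_mono le_trans mult_zero_right order_antisym)
  then have "rinner (A *\<^sub>v p) (A *\<^sub>v q) = 0"
    using abs_rinner_le[of "A *\<^sub>v p" m "A *\<^sub>v q"] by auto
  moreover have "rinner p q = 0"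
    using abs_rinner_le[OF p(1) q(1)] True by auto
  ultimately show ?thesis
    using True by auto
next
  case False
  define a b where "a = norm2_vec p" and "b = norm2_vec q"
  have pos: "a > 0" "b > 0"
    using False norm2_vec_nonneg[of p] norm2_vec_nonneg[of q] by (auto simp: a_def b_def less_le)
  let ?p = "complex_of_real b \<cdot>\<^sub>v p" and ?q = "complex_of_real a \<cdot>\<^sub>v q"
  have "rinner (A *\<^sub>v ?p) (A *\<^sub>v ?q) - rinner ?p ?q \<le> \<delta> / 2 * ((norm2_vec ?p)\<^sup>2 + (norm2_vec ?q)\<^sup>2)"
    using p q T by (intro parallelogram_bound[of _ T]) (simp_all add: order_trans[OF supp_vec_smult])
  also have "\<dots> = (a * b) * (\<delta> * a * b)"
    using pos by (simp add: norm2_vec_smult flip: a_def b_def) (simp add: power2_eq_square)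
  also have "rinner (A *\<^sub>v ?p) (A *\<^sub>v ?q) - rinner ?p ?q = (a * b) * (rinner (A *\<^sub>v p) (A *\<^sub>v q) - rinner p q)"
    using p(1) q(1) smult_carrier_vec[of "complex_of_real a" q n] smult_carrier_vec[of "complex_of_real a" "A *\<^sub>v q" m]
      rinner_smult_left[of p n ?q b] rinner_smult_right[of p n q a]
      rinner_smult_left[of "A *\<^sub>v p" m "complex_of_real a \<cdot>\<^sub>v (A *\<^sub>v q)" b]
      rinner_smult_right[of "A *\<^sub>v p" m "A *\<^sub>v q" a]
    by (simp add: mult_smult right_diff_distrib)
  finally show ?thesis
    using pos unfolding a_def[symmetric] b_def[symmetric]
    by (simp add: mult_le_cancel_left_pos)
qed

text \<open>Replacing \<open>p\<close> by its negative flips the sign of both products and keeps the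
  norm.\<close>

lemma near_isometry:
  assumes p: "p \<in> carrier_vec n" "supp_vec p \<subseteq> T" and q: "q \<in> carrier_vec n" "supp_vec q \<subseteq> T"
    and T: "finite T" "card T \<le> r"
  shows "\<bar>rinner (A *\<^sub>v p) (A *\<^sub>v q) - rinner p q\<bar> \<le> \<delta> * norm2_vec p * norm2_vec q"
proof -
  let ?p = "complex_of_real (- 1) \<cdot>\<^sub>v p"
  have "rinner (A *\<^sub>v ?p) (A *\<^sub>v q) - rinner ?p q \<le> \<delta> * norm2_vec ?p * norm2_vec q"
    using p q T by (intro near_isometry_upper[of _ T]) (simp_all add: order_trans[OF supp_vec_smult])
  also have "rinner (A *\<^sub>v ?p) (A *\<^sub>v q) - rinner ?p q = - (rinner (A *\<^sub>v p) (A *\<^sub>v q) - rinner p q)"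
    using p(1) q(1) mult_smult[OF p(1), of "complex_of_real (- 1)"] rinner_smult_left[of p n q "-1"]
      rinner_smult_left[of "A *\<^sub>v p" m "A *\<^sub>v q" "-1"] by simp
  finally show ?thesis
    using near_isometry_upper[OF assms] by (simp add: norm2_vec_smult)
qed

lemma rinner_mult_le:
  assumes "x \<in> carrier_vec n" "card (supp_vec x) \<le> r" "e \<in> carrier_vec m"
  shows "\<bar>rinner (A *\<^sub>v x) e\<bar> \<le> norm2_vec x * (sqrt (1 + \<delta>) * norm2_vec e)"
proof -
  have "\<bar>rinner (A *\<^sub>v x) e\<bar> \<le> norm2_vec (A *\<^sub>v x) * norm2_vec e"
    using assms by (intro abs_rinner_le[of _ m]) auto
  also have "\<dots> \<le> (sqrt (1 + \<delta>) * norm2_vec x) * norm2_vec e"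
    using assms by (intro mult_right_mono norm2_mult_le) auto
  finally show ?thesis by (simp add: mult_ac)
qed

text \<open>With \<open>d\<close> the current error, \<open>A d + e\<close> is the residual; its
  pairing with \<open>A p\<close> reproduces \<open>rinner p d\<close> up to near isometry and
  noise.\<close>

lemma abs_rinner_residual_le:
  assumes p: "p \<in> carrier_vec n" "supp_vec p \<subseteq> T" and d: "d \<in> carrier_vec n" "supp_vec d \<subseteq> T"
    and T: "finite T" "card T \<le> r" and e: "e \<in> carrier_vec m"
  shows "\<bar>rinner (A *\<^sub>v p) (A *\<^sub>v d + e) - rinner p d\<bar>
           \<le> norm2_vec p * (\<delta> * norm2_vec d + sqrt (1 + \<delta>) * norm2_vec e)"
proof -
  have card: "card (supp_vec p) \<le> r"
    using p T card_mono le_trans by metis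
  have "rinner (A *\<^sub>v p) (A *\<^sub>v d + e) = rinner (A *\<^sub>v p) (A *\<^sub>v d) + rinner (A *\<^sub>v p) e"
    using e by (intro rinner_add_right[of _ m]) auto
  then show ?thesis
    using near_isometry[OF p d T] rinner_mult_le[OF p(1) card e] by (simp add: algebra_simps)
qed

text \<open>The missed part \<open>d'\<close> of \<open>d\<close> pairs with \<open>y\<close> to
  nearly its own squared norm. The same pairing is small, since \<open>y\<close> on missed indices
  is dominated by \<open>y\<close> on wrongly selected ones, where \<open>d\<close> vanishes. Each
  estimate costs one \<beta>.\<close>

lemma identification:
  assumes d: "d \<in> carrier_vec n" "card (supp_vec d) \<le> k" and k: "2 * k \<le> r" and e: "e \<in> carrier_vec m"
  defines "y \<equiv> mat_adjoint A *\<^sub>v (A *\<^sub>v d + e)"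
  shows "norm2_vec (restrict_vec d (- supp_vec (best_sparse k y)))
           \<le> 2 * (\<delta> * norm2_vec d + sqrt (1 + \<delta>) * norm2_vec e)"
proof -
  define R L \<Omega> where "R = supp_vec d" and "L = largest_indices k y" and "\<Omega> = supp_vec (best_sparse k y)"
  define \<beta> where "\<beta> = \<delta> * norm2_vec d + sqrt (1 + \<delta>) * norm2_vec e"
  have \<beta>: "0 \<le> \<beta>"
    using \<delta>_nonneg by (simp add: \<beta>_def)
  have y: "y \<in> carrier_vec n"
    unfolding y_def using mat_adjoint_carrier[OF mat_carrier] e by (intro mult_mat_vec_carrier) auto
  have v: "A *\<^sub>v d + e \<in> carrier_vec m"
    using e by simp
  have \<Omega>: "\<Omega> = supp_vec y \<inter> L"
    by (simp add: \<Omega>_def L_def supp_best_sparse)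
  \<comment> \<open>Both sets have at most \<open>k\<close> elements, so all test vectors share a
    support set of size at most \<open>2 * k\<close>.\<close>
  have "card (R \<union> L) \<le> card R + card L"
    by (rule card_Un_le)
  then have card: "card (R \<union> L) \<le> r"
    using d k by (simp add: R_def L_def card_largest_indices)
  have fin: "finite (R \<union> L)"
    by (simp add: R_def L_def)
  have adj: "rinner z y = rinner (A *\<^sub>v z) (A *\<^sub>v d + e)" if "z \<in> carrier_vec n" for z
    unfolding y_def using rinner_mat_adjoint[OF mat_carrier that v] by simp
  define w where "w = restrict_vec y (L - R)"
  define d' where "d' = restrict_vec d (- \<Omega>)"
  have w: "w \<in> carrier_vec n" "supp_vec w \<subseteq> R \<union> L"
    using y by (auto simp: w_def supp_restrict_vec)
  have d': "d' \<in> carrier_vec n" "supp_vec d' \<subseteq> R \<union> L"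
    using d by (auto simp: d'_def supp_restrict_vec R_def)
  \<comment> \<open>\<open>w\<close> lives off the support of \<open>d\<close>, so its pairing with
    \<open>y\<close>, which is |w|^2, consists of error terms only.\<close>
  have "rinner w d = 0"
    unfolding rinner_def
  proof (intro sum.neutral ballI)
    fix i assume "i \<in> {..<dim_vec w}"
    then show "inner (w $ i) (d $ i) = 0"
      using y d by (cases "i \<in> R") (auto simp: w_def R_def supp_vec_def)
  qed
  then have "(norm2_vec w)\<^sup>2 \<le> norm2_vec w * \<beta>"
    using abs_rinner_residual_le[OF w d(1) _ fin card e] adj[OF w(1)] rinner_restrict_vec_self[of y "L - R"]
    by (simp add: R_def w_def \<beta>_def)
  then have w_le: "norm2_vec w \<le> \<beta>"
    using \<beta> by (rule le_if_power2_le_mult)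
  \<comment> \<open>\<Omega> may be smaller than \<open>L\<close>, but only by indices where
    \<open>y\<close> is zero.\<close>
  have "norm2_vec (restrict_vec y (R - \<Omega>)) \<le> norm2_vec (restrict_vec y (R - L))"
    by (rule norm2_restrict_vec_mono) (auto simp: \<Omega>)
  also have "\<dots> \<le> norm2_vec w"
    using norm2_restrict_largest_indices[of R y k] d y supp_vec_subset[OF d(1)]
    by (simp add: R_def L_def w_def)
  finally have y_le: "norm2_vec (restrict_vec y (R - \<Omega>)) \<le> \<beta>"
    using w_le by simp
  have d'_eq: "d' = restrict_vec d (R - \<Omega>)"
    unfolding d'_def by (intro eq_vecI) (auto simp: R_def supp_vec_def)
  have "\<bar>rinner d' y\<bar> \<le> norm2_vec d' * norm2_vec (restrict_vec y (R - \<Omega>))"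
    unfolding d'_eq using rinner_restrict_vec_left[OF d(1) y, of "R - \<Omega>"]
      abs_rinner_le[of "restrict_vec d (R - \<Omega>)" n "restrict_vec y (R - \<Omega>)"] d y by simp
  also have "\<dots> \<le> norm2_vec d' * \<beta>"
    using y_le by (intro mult_left_mono) auto
  finally have "\<bar>rinner d' y\<bar> \<le> norm2_vec d' * \<beta>" .
  moreover have "\<bar>rinner d' y - (norm2_vec d')\<^sup>2\<bar> \<le> norm2_vec d' * \<beta>"
    using abs_rinner_residual_le[OF d' d(1) _ fin card e] adj[OF d'(1)] rinner_restrict_vec_self[of d "- \<Omega>"]
    by (simp add: R_def d'_def \<beta>_def)
  ultimately have "(norm2_vec d')\<^sup>2 \<le> 2 * (norm2_vec d' * \<beta>)"
    by linarith
  then have "(norm2_vec d')\<^sup>2 \<le> norm2_vec d' * (2 * \<beta>)"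
    by (simp add: mult_ac)
  then show ?thesis
    unfolding d'_def \<Omega>_def \<beta>_def[symmetric] by (rule le_if_power2_le_mult) (use \<beta> in simp)
qed

text \<open>The least-squares residual is orthogonal to the image of the error restricted to
  \<open>T\<close>, so near isometry bounds that restriction. Off \<open>T\<close> the error is just
  \<open>x\<close>.\<close>

lemma estimation:
  assumes x: "x \<in> carrier_vec n" and b: "b \<in> carrier_vec n" "supp_vec b \<subseteq> T"
    and T: "finite T" "card (supp_vec x \<union> T) \<le> r" and e: "e \<in> carrier_vec m"
    and normal: "\<And>z. z \<in> carrier_vec n \<Longrightarrow> supp_vec z \<subseteq> T \<Longrightarrow>
      rinner (A *\<^sub>v z) (A *\<^sub>v x + e - A *\<^sub>v b) = 0"
  shows "(1 - \<delta>) * norm2_vec (x - b) \<le> norm2_vec (restrict_vec x (- T)) + sqrt (1 + \<delta>) * norm2_vec e"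
proof -
  define d where "d = x - b"
  define d' where "d' = restrict_vec d T"
  have d: "d \<in> carrier_vec n" "supp_vec d \<subseteq> supp_vec x \<union> T"
    using x b supp_vec_diff[OF x b(1)] by (auto simp: d_def)
  have d': "d' \<in> carrier_vec n" "supp_vec d' \<subseteq> T" "supp_vec d' \<subseteq> supp_vec x \<union> T"
    using d(1) by (auto simp: d'_def supp_restrict_vec)
  have "A *\<^sub>v x + e - A *\<^sub>v b = A *\<^sub>v d + e"
    using e mat_carrier x b mult_diff[OF x b(1)] by (intro eq_vecI) (auto simp: d_def)
  then have "rinner (A *\<^sub>v d') (A *\<^sub>v d + e) = 0"
    using normal[OF d'(1,2)] by simp
  then have "(norm2_vec d')\<^sup>2 \<le> norm2_vec d' * (\<delta> * norm2_vec d + sqrt (1 + \<delta>) * norm2_vec e)"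
    using abs_rinner_residual_le[OF d'(1,3) d _ T(2) e] T(1) rinner_restrict_vec_self[of d T]
    by (simp add: d'_def)
  then have "norm2_vec d' \<le> \<delta> * norm2_vec d + sqrt (1 + \<delta>) * norm2_vec e"
    by (rule le_if_power2_le_mult) (simp add: \<delta>_nonneg)
  moreover have "norm2_vec d \<le> norm2_vec d' + norm2_vec (restrict_vec d (- T))"
    using norm2_vec_triangle[of d' n "restrict_vec d (- T)"] restrict_vec_split[of d T] d d'
    by (simp add: d'_def)
  moreover have "restrict_vec d (- T) = restrict_vec x (- T)"
    using x b by (intro eq_vecI) (auto simp: d_def supp_vec_def)
  \<comment> \<open>The term \<delta> |d| moves to the left and leaves the factor
    \<open>1 - \<delta>\<close>.\<close>
  ultimately show ?thesis
    by (simp add: d_def algebra_simps)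
qed

(* One block of s entries is split off at each step: its entries are at most the average
   magnitude of the previous block. *)
lemma norm2_mult_tail_le:
  assumes "0 < s" "s \<le> r" "h \<in> carrier_vec n"
  shows "norm2_vec (A *\<^sub>v (h - best_sparse s h)) \<le> sqrt (1 + \<delta>) * (norm1_vec h / sqrt s)"
  using assms(3)
proof (induction "card (supp_vec h)" arbitrary: h rule: less_induct)
  case less
  define L where "L = largest_indices s h"
  define g where "g = restrict_vec h (- L)"
  have h: "h \<in> carrier_vec n" and dim: "dim_vec h = n"
    using less.prems by auto
  have g: "g \<in> carrier_vec n" "h - best_sparse s h = g"
    using h by (simp_all add: g_def L_def best_sparse_def minus_restrict_vec)
  show ?case
  proof (cases "supp_vec g = {}")
    case True
    have "norm2_vec g = 0"
      using True by (auto simp: norm2_vec_def supp_vec_def intro!: L2_set_0')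
    then have "norm2_vec (A *\<^sub>v g) \<le> 0"
      using norm2_mult_le[OF g(1)] True by simp
    also have "0 \<le> sqrt (1 + \<delta>) * (norm1_vec h / sqrt s)"
      using \<delta>_nonneg by (simp add: norm1_vec_def sum_nonneg)
    finally show ?thesis
      by (simp add: g(2))
  next
    case False
    then obtain j where "j \<in> supp_vec h \<inter> - L"
      unfolding g_def supp_restrict_vec by blast
    then have j: "j < n" "j \<notin> L" "h $ j \<noteq> 0"
      unfolding supp_vec_def dim by simp_all
    \<comment> \<open>A nonzero entry outside \<open>L\<close> shows that \<open>L\<close> is not
      the whole index set, so it has exactly \<open>s\<close> elements.\<close>
    have "card L \<noteq> n"
    proof
      assume "card L = n"
      then have "L = {..<n}"
        using largest_indices_subset[of s h] dim by (intro card_subset_eq) (auto simp: L_def)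
      with j show False by simp
    qed
    then have cardL: "card L = s"
      using dim by (auto simp: L_def card_largest_indices min_def split: if_splits)
    have ge: "cmod (h $ k) \<le> cmod (h $ i)" if "i \<in> L" "k < n" "k \<notin> L" for i k
      using that largest_indices_ge[of i s h k] dim by (simp add: L_def)
    \<comment> \<open>The entries on \<open>L\<close> are at least the nonzero |h j|, so removing
      the block strictly shrinks the support, the induction measure.\<close>
    have "supp_vec g \<subset> supp_vec h"
    proof -
      obtain i where i: "i \<in> L"
        using cardL assms(1) by fastforce
      moreover have "h $ i \<noteq> 0"
        using ge[OF i j(1,2)] j(3) by auto
      moreover have "i < n"
        using i largest_indices_subset[of s h] dim by (auto simp: L_def)
      ultimately have "i \<in> supp_vec h - supp_vec g"
        unfolding g_def supp_restrict_vec supp_vec_def dim by simp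
      moreover have "supp_vec g \<subseteq> supp_vec h"
        unfolding g_def supp_restrict_vec by simp
      ultimately show ?thesis by blast
    qed
    then have card: "card (supp_vec g) < card (supp_vec h)"
      by (intro psubset_card_mono) auto
    define M where "M = (\<Sum>i\<in>L. cmod (h $ i))"
    have le_M: "s * cmod (g $ k) \<le> M" if "k < n" for k
    proof (cases "k \<in> L")
      case True
      then show ?thesis
        using that dim by (simp add: g_def M_def sum_nonneg)
    next
      case False
      have "card L * cmod (h $ k) \<le> M"
        unfolding M_def using ge that False by (intro sum_bounded_below) auto
      then show ?thesis
        using False that dim by (simp add: g_def cardL)
    qed
    have norm1: "norm1_vec h = M + norm1_vec g"
    proof -
      have "norm1_vec h = sum (\<lambda>i. cmod (h $ i)) L + sum (\<lambda>i. cmod (h $ i)) ({..<n} - L)"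
        using sum.subset_diff[of L "{..<n}" "\<lambda>i. cmod (h $ i)"] largest_indices_subset[of s h] dim
        by (simp add: norm1_vec_def L_def)
      also have "sum (\<lambda>i. cmod (h $ i)) ({..<n} - L) = norm1_vec g"
        unfolding norm1_vec_def using dim by (intro sum.mono_neutral_cong_left) (auto simp: g_def)
      finally show ?thesis by (simp add: M_def)
    qed
    \<comment> \<open>At most \<open>s\<close> entries, each at most \<open>M / s\<close>, have
      Euclidean norm at most \<open>M / sqrt s\<close>.\<close>
    have best: "norm2_vec (best_sparse s g) \<le> M / sqrt s"
    proof (rule power2_le_imp_le)
      have M0: "0 \<le> M"
        by (simp add: M_def sum_nonneg)
      then show "0 \<le> M / sqrt s"
        by simp
      have "(norm2_vec (best_sparse s g))\<^sup>2 = (\<Sum>i\<in>largest_indices s g. (cmod (g $ i))\<^sup>2)"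
        using largest_indices_subset[of s g]
        by (simp add: best_sparse_def norm2_restrict_vec_power2 Int_absorb1)
      also have "\<dots> \<le> card (largest_indices s g) * (M / s)\<^sup>2"
      proof (rule sum_bounded_above)
        fix i assume "i \<in> largest_indices s g"
        then have "i < n"
          using largest_indices_subset[of s g] g by auto
        then show "(cmod (g $ i))\<^sup>2 \<le> (M / s)\<^sup>2"
          using le_M[of i] assms(1) by (intro power_mono) (auto simp: field_simps)
      qed
      also have "\<dots> \<le> s * (M / s)\<^sup>2"
        by (intro mult_right_mono) (auto simp: card_largest_indices)
      also have "\<dots> = (M / sqrt s)\<^sup>2"
        using assms(1) by (simp add: power_divide power2_eq_square)
      finally show "(norm2_vec (best_sparse s g))\<^sup>2 \<le> (M / sqrt s)\<^sup>2" .
    qed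
    have bs: "best_sparse s g \<in> carrier_vec n" "card (supp_vec (best_sparse s g)) \<le> r"
      using g(1) card_supp_best_sparse[of s g] assms(2) by auto
    have "g = best_sparse s g + (g - best_sparse s g)"
      using g bs by (intro eq_vecI) auto
    then have "A *\<^sub>v g = A *\<^sub>v best_sparse s g + A *\<^sub>v (g - best_sparse s g)"
      using mult_add[OF bs(1), of "g - best_sparse s g"] g(1) bs(1) by simp
    then have "norm2_vec (A *\<^sub>v g)
        \<le> norm2_vec (A *\<^sub>v best_sparse s g) + norm2_vec (A *\<^sub>v (g - best_sparse s g))"
      using norm2_vec_triangle[of "A *\<^sub>v best_sparse s g" m "A *\<^sub>v (g - best_sparse s g)"] by simp
    also have "\<dots> \<le> sqrt (1 + \<delta>) * (M / sqrt s) + sqrt (1 + \<delta>) * (norm1_vec g / sqrt s)"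
    proof (rule add_mono)
      show "norm2_vec (A *\<^sub>v best_sparse s g) \<le> sqrt (1 + \<delta>) * (M / sqrt s)"
        using order_trans[OF norm2_mult_le[OF bs] mult_left_mono[OF best]] \<delta>_nonneg by simp
      show "norm2_vec (A *\<^sub>v (g - best_sparse s g)) \<le> sqrt (1 + \<delta>) * (norm1_vec g / sqrt s)"
        by (rule less.hyps[OF card g(1)])
    qed
    also have "\<dots> = sqrt (1 + \<delta>) * (norm1_vec h / sqrt s)"
      by (simp add: norm1 algebra_simps add_divide_distrib)
    finally show ?thesis
      by (simp add: g(2))
  qed
qed

text \<open>The leading block is sparse and is charged to the Euclidean norm; the remaining blocks
  are charged to the 1-norm.\<close>

lemma norm2_mult_le_norm1:
  assumes "0 < s" "s \<le> r" and h: "h \<in> carrier_vec n"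
  shows "norm2_vec (A *\<^sub>v h) \<le> sqrt (1 + \<delta>) * (norm2_vec h + norm1_vec h / sqrt s)"
proof -
  let ?b = "best_sparse s h"
  have b: "?b \<in> carrier_vec n" "card (supp_vec ?b) \<le> r"
    using h card_supp_best_sparse[of s h] assms(2) by auto
  have "h = ?b + (h - ?b)"
    using h b by (intro eq_vecI) auto
  then have "A *\<^sub>v h = A *\<^sub>v ?b + A *\<^sub>v (h - ?b)"
    using mult_add[OF b(1), of "h - ?b"] h b(1) by simp
  then have "norm2_vec (A *\<^sub>v h) \<le> norm2_vec (A *\<^sub>v ?b) + norm2_vec (A *\<^sub>v (h - ?b))"
    using norm2_vec_triangle[of "A *\<^sub>v ?b" m "A *\<^sub>v (h - ?b)"] by simp
  also have "norm2_vec (A *\<^sub>v ?b) \<le> sqrt (1 + \<delta>) * norm2_vec ?b"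
    by (rule norm2_mult_le[OF b])
  also have "norm2_vec ?b \<le> norm2_vec h"
    by (simp add: best_sparse_def norm2_restrict_vec_le)
  also have "norm2_vec (A *\<^sub>v (h - ?b)) \<le> sqrt (1 + \<delta>) * (norm1_vec h / sqrt s)"
    by (rule norm2_mult_tail_le[OF assms])
  finally show ?thesis
    using \<delta>_nonneg by (simp add: distrib_left mult_left_mono)
qed

end

section \<open>Existence of the least restricted isometry constant\<close>

lemma cmod_index_le_norm2_vec: "i < dim_vec x \<Longrightarrow> cmod (x $ i) \<le> norm2_vec x"
  unfolding norm2_vec_def by (rule member_le_L2_set[of _ _ "\<lambda>i. cmod (x $ i)"]) auto

lemma norm2_vec_le_norm1_vec: "norm2_vec x \<le> norm1_vec x"
  unfolding norm2_vec_def norm1_vec_def by (rule L2_set_le_sum) auto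

text \<open>The sum of all moduli is a crude constant; only finiteness matters, to provide one
  admissible isometry constant.\<close>

lemma norm2_mult_mat_vec_bounded:
  assumes A: "A \<in> carrier_mat m n"
  shows "\<exists>C\<ge>0. \<forall>x\<in>carrier_vec n. norm2_vec (A *\<^sub>v x) \<le> C * norm2_vec x"
proof (intro exI conjI ballI)
  let ?C = "\<Sum>i<m. \<Sum>j<n. cmod (A $$ (i, j))"
  show "0 \<le> ?C"
    by (intro sum_nonneg) auto
  fix x :: "complex vec" assume x: "x \<in> carrier_vec n"
  have "norm2_vec (A *\<^sub>v x) \<le> (\<Sum>i<m. cmod ((A *\<^sub>v x) $ i))"
    using norm2_vec_le_norm1_vec[of "A *\<^sub>v x"] A by (simp add: norm1_vec_def)
  also have "\<dots> \<le> (\<Sum>i<m. \<Sum>j<n. cmod (A $$ (i, j)) * norm2_vec x)"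
  proof (rule sum_mono)
    fix i assume "i \<in> {..<m}"
    then have "(A *\<^sub>v x) $ i = (\<Sum>j<n. A $$ (i, j) * x $ j)"
      using A x by (simp add: scalar_prod_def atLeast0LessThan)
    also have "cmod \<dots> \<le> (\<Sum>j<n. cmod (A $$ (i, j)) * cmod (x $ j))"
      by (rule order_trans[OF norm_sum]) (simp add: norm_mult)
    also have "\<dots> \<le> (\<Sum>j<n. cmod (A $$ (i, j)) * norm2_vec x)"
      using x by (intro sum_mono mult_left_mono cmod_index_le_norm2_vec) auto
    finally show "cmod ((A *\<^sub>v x) $ i) \<le> (\<Sum>j<n. cmod (A $$ (i, j)) * norm2_vec x)" .
  qed
  also have "\<dots> = ?C * norm2_vec x"
    by (simp add: sum_distrib_right)
  finally show "norm2_vec (A *\<^sub>v x) \<le> ?C * norm2_vec x" .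
qed

text \<open>\<open>LEAST\<close> has meaning only if a minimum exists. The admissible constants are
  nonempty and bounded below, and they are cut out by weak inequalities affine in \<delta>, so their
  infimum is admissible.\<close>

lemma restricted_isometry_const_bounds:
  assumes A: "A \<in> carrier_mat m n" and "0 < n" "0 < r"
    and x: "x \<in> carrier_vec n" "sparse_vec r x"
  defines "\<delta> \<equiv> restricted_isometry_const r A"
  shows "(1 - \<delta>) * (norm2_vec x)\<^sup>2 \<le> (norm2_vec (A *\<^sub>v x))\<^sup>2"
    and "(norm2_vec (A *\<^sub>v x))\<^sup>2 \<le> (1 + \<delta>) * (norm2_vec x)\<^sup>2"
proof -
  define P where "P = (\<lambda>\<delta>. \<forall>x\<in>carrier_vec (dim_col A). sparse_vec r x \<longrightarrow>
     (1 - \<delta>) * (norm2_vec x)\<^sup>2 \<le> (norm2_vec (A *\<^sub>v x))\<^sup>2 \<and>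
     (norm2_vec (A *\<^sub>v x))\<^sup>2 \<le> (1 + \<delta>) * (norm2_vec x)\<^sup>2)"
  have dim: "dim_col A = n"
    using A by simp
  obtain C where C: "0 \<le> C" "\<And>x. x \<in> carrier_vec n \<Longrightarrow> norm2_vec (A *\<^sub>v x) \<le> C * norm2_vec x"
    using norm2_mult_mat_vec_bounded[OF A] by blast
  \<comment> \<open>With this value the lower bound has a nonpositive left side and is
    trivial.\<close>
  have P_ex: "P (1 + C\<^sup>2)"
    unfolding P_def dim
  proof (intro ballI impI conjI)
    fix x :: "complex vec" assume x: "x \<in> carrier_vec n"
    have "(norm2_vec (A *\<^sub>v x))\<^sup>2 \<le> C\<^sup>2 * (norm2_vec x)\<^sup>2"
      using power_mono[OF C(2)[OF x], of 2] by (simp add: power_mult_distrib)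
    also have "\<dots> \<le> (1 + (1 + C\<^sup>2)) * (norm2_vec x)\<^sup>2"
      by (intro mult_right_mono) auto
    finally show "(norm2_vec (A *\<^sub>v x))\<^sup>2 \<le> (1 + (1 + C\<^sup>2)) * (norm2_vec x)\<^sup>2" .
    have "(1 - (1 + C\<^sup>2)) * (norm2_vec x)\<^sup>2 \<le> 0"
      by (intro mult_nonpos_nonneg) auto
    also have "0 \<le> (norm2_vec (A *\<^sub>v x))\<^sup>2"
      by simp
    finally show "(1 - (1 + C\<^sup>2)) * (norm2_vec x)\<^sup>2 \<le> (norm2_vec (A *\<^sub>v x))\<^sup>2" .
  qed
  \<comment> \<open>One nonzero sparse vector forces every admissible constant to be
    nonnegative.\<close>
  define z where "z = (unit_vec n 0 :: complex vec)"
  have z: "z \<in> carrier_vec n" "sparse_vec r z" "norm2_vec z \<noteq> 0"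
  proof -
    show "z \<in> carrier_vec n"
      by (simp add: z_def)
    have "supp_vec z = {0}"
      using \<open>0 < n\<close> unfolding z_def supp_vec_def by (auto split: if_splits)
    then show "sparse_vec r z"
      using \<open>0 < r\<close> by (simp add: sparse_vec_def norm0_vec_def)
    show "norm2_vec z \<noteq> 0"
      using cmod_index_le_norm2_vec[of 0 z] \<open>0 < n\<close> by (simp add: z_def)
  qed
  have bdd: "bdd_below (Collect P)"
  proof (rule bdd_belowI)
    fix \<delta> assume "\<delta> \<in> Collect P"
    then have "(1 - \<delta>) * (norm2_vec z)\<^sup>2 \<le> (norm2_vec (A *\<^sub>v z))\<^sup>2 \<and>
        (norm2_vec (A *\<^sub>v z))\<^sup>2 \<le> (1 + \<delta>) * (norm2_vec z)\<^sup>2"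
      using z(1,2) unfolding P_def dim by blast
    then have "(1 - \<delta>) * (norm2_vec z)\<^sup>2 \<le> (1 + \<delta>) * (norm2_vec z)\<^sup>2"
      by linarith
    then have "0 \<le> \<delta> * (norm2_vec z)\<^sup>2"
      by (simp add: algebra_simps)
    then show "0 \<le> \<delta>"
      using z(3) by (simp add: zero_le_mult_iff)
  qed
  define D where "D = Inf (Collect P)"
  \<comment> \<open>Passage to the infimum: divide by \<open>S\<close>; if \<open>S\<close> is 0,
    any one admissible constant gives the claim.\<close>
  have D_ge: "K \<le> D * S" if "0 \<le> S" "\<And>\<delta>. P \<delta> \<Longrightarrow> K \<le> \<delta> * S" for K S
  proof (cases "S = 0")
    case True
    then show ?thesis using that(2)[OF P_ex] by simp
  next
    case False
    then have "S > 0" using that(1) by simp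
    have "K / S \<le> D"
      unfolding D_def using P_ex that(2) \<open>S > 0\<close> by (intro cInf_greatest) (auto simp: divide_le_eq)
    then show ?thesis
      using \<open>S > 0\<close> by (simp add: divide_le_eq)
  qed
  have "P D"
    unfolding P_def dim
  proof (intro ballI impI conjI)
    fix x :: "complex vec" assume x: "x \<in> carrier_vec n" "sparse_vec r x"
    have "(norm2_vec x)\<^sup>2 - (norm2_vec (A *\<^sub>v x))\<^sup>2 \<le> D * (norm2_vec x)\<^sup>2"
    proof (rule D_ge)
      fix \<delta> assume "P \<delta>"
      then have "(1 - \<delta>) * (norm2_vec x)\<^sup>2 \<le> (norm2_vec (A *\<^sub>v x))\<^sup>2"
        using x unfolding P_def dim by blast
      then show "(norm2_vec x)\<^sup>2 - (norm2_vec (A *\<^sub>v x))\<^sup>2 \<le> \<delta> * (norm2_vec x)\<^sup>2"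
        by (simp add: algebra_simps)
    qed simp
    then show "(1 - D) * (norm2_vec x)\<^sup>2 \<le> (norm2_vec (A *\<^sub>v x))\<^sup>2"
      by (simp add: algebra_simps)
    have "(norm2_vec (A *\<^sub>v x))\<^sup>2 - (norm2_vec x)\<^sup>2 \<le> D * (norm2_vec x)\<^sup>2"
    proof (rule D_ge)
      fix \<delta> assume "P \<delta>"
      then have "(norm2_vec (A *\<^sub>v x))\<^sup>2 \<le> (1 + \<delta>) * (norm2_vec x)\<^sup>2"
        using x unfolding P_def dim by blast
      then show "(norm2_vec (A *\<^sub>v x))\<^sup>2 - (norm2_vec x)\<^sup>2 \<le> \<delta> * (norm2_vec x)\<^sup>2"
        by (simp add: algebra_simps)
    qed simp
    then show "(norm2_vec (A *\<^sub>v x))\<^sup>2 \<le> (1 + D) * (norm2_vec x)\<^sup>2"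
      by (simp add: algebra_simps)
  qed
  moreover have "D \<le> \<delta>'" if "P \<delta>'" for \<delta>'
    unfolding D_def using that bdd by (intro cInf_lower) auto
  ultimately have "Least P = D"
    by (rule Least_equality)
  moreover have "\<delta> = Least P"
    unfolding \<delta>_def restricted_isometry_const_def P_def ..
  ultimately have "P \<delta>"
    using \<open>P D\<close> by simp
  then show "(1 - \<delta>) * (norm2_vec x)\<^sup>2 \<le> (norm2_vec (A *\<^sub>v x))\<^sup>2"
    "(norm2_vec (A *\<^sub>v x))\<^sup>2 \<le> (1 + \<delta>) * (norm2_vec x)\<^sup>2"
    using x unfolding P_def dim by blast+
qed

text \<open>Both inequalities weaken as \<delta> grows. For \<open>n = 0\<close> the least constant
  is unspecified, but all norms vanish.\<close>

lemma restricted_isometryI: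
  assumes A: "A \<in> carrier_mat m n" and r: "0 < r"
    and \<delta>: "restricted_isometry_const r A \<le> \<delta>" "0 \<le> \<delta>"
  shows "restricted_isometry A m n r \<delta>"
proof
  fix x :: "complex vec" assume x: "x \<in> carrier_vec n" "card (supp_vec x) \<le> r"
  have "(1 - \<delta>) * (norm2_vec x)\<^sup>2 \<le> (norm2_vec (A *\<^sub>v x))\<^sup>2 \<and>
    (norm2_vec (A *\<^sub>v x))\<^sup>2 \<le> (1 + \<delta>) * (norm2_vec x)\<^sup>2"
  proof (cases "n = 0")
    case True
    have "norm2_vec x = 0"
      using x(1) True by (simp add: norm2_vec_def)
    moreover have "norm2_vec (A *\<^sub>v x) = 0"
      using norm2_mult_mat_vec_bounded[OF A] x(1) \<open>norm2_vec x = 0\<close> norm2_vec_nonneg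
      by (metis mult_zero_right order_antisym)
    ultimately show ?thesis by simp
  next
    case False
    let ?\<delta> = "restricted_isometry_const r A"
    have "(1 - \<delta>) * (norm2_vec x)\<^sup>2 \<le> (1 - ?\<delta>) * (norm2_vec x)\<^sup>2"
      "(1 + ?\<delta>) * (norm2_vec x)\<^sup>2 \<le> (1 + \<delta>) * (norm2_vec x)\<^sup>2"
      using \<delta> by (intro mult_right_mono; simp)+
    then show ?thesis
      using restricted_isometry_const_bounds[OF A _ r x(1)] False x(2)
      by (auto simp: sparse_vec_def norm0_vec_def intro: order_trans)
  qed
  then show "(1 - \<delta>) * (norm2_vec x)\<^sup>2 \<le> (norm2_vec (A *\<^sub>v x))\<^sup>2"
    "(norm2_vec (A *\<^sub>v x))\<^sup>2 \<le> (1 + \<delta>) * (norm2_vec x)\<^sup>2"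
    by blast+
qed (use A \<delta> in auto)

section \<open>Recursion for the iterates, contraction, and the final constants\<close>

section \<open>Convergence of CoSaMP\<close>

lemma cosamp_0: "cosamp A u s 0 = 0\<^sub>v (dim_col A)"
  by (simp add: cosamp_def cosamp_state_def)

text \<open>The stored residual is determined by the approximation, also at the start, where a^0 = 0
  and v = u. The iteration is thus a recursion in the approximation alone.\<close>

lemma cosamp_state_residual:
  assumes "A \<in> carrier_mat m n" "u \<in> carrier_vec m"
  shows "cosamp_state A u s k = (cosamp A u s k, u - A *\<^sub>v cosamp A u s k)"
proof (cases k)
  case 0
  have "u - A *\<^sub>v 0\<^sub>v n = u"
    using assms by (intro eq_vecI) auto
  then show ?thesis
    using assms 0 by (simp add: cosamp_def cosamp_state_def)
next
  case (Suc k')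
  then show ?thesis
    by (simp add: cosamp_def cosamp_state_def cosamp_step_def Let_def split: prod.splits)
qed

lemma cosamp_Suc:
  fixes s :: nat
  assumes "A \<in> carrier_mat m n" "u \<in> carrier_vec m"
  defines "a \<equiv> cosamp A u s"
  defines "T k \<equiv> supp_vec (best_sparse (2 * s) (mat_adjoint A *\<^sub>v (u - A *\<^sub>v a k))) \<union> supp_vec (a k)"
  shows "a (Suc k) = best_sparse s (extend_vec n (T k) (pseudo_inverse (column_submatrix A (T k)) *\<^sub>v u))"
proof -
  have "cosamp_state A u s (Suc k) = cosamp_step A u s (cosamp_state A u s k)"
    by (simp add: cosamp_state_def)
  then show ?thesis
    using assms(1) cosamp_state_residual[OF assms(1,2), of s k]
    by (simp add: cosamp_def[of A u s "Suc k"] a_def T_def cosamp_step_def Let_def)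
qed

lemma cosamp_carrier_sparse:
  assumes "A \<in> carrier_mat m n" "u \<in> carrier_vec m"
  shows "cosamp A u s k \<in> carrier_vec n" "card (supp_vec (cosamp A u s k)) \<le> s"
proof -
  have "cosamp A u s k \<in> carrier_vec n \<and> card (supp_vec (cosamp A u s k)) \<le> s"
  proof (cases k)
    case 0
    have "supp_vec (0\<^sub>v n) = {}"
      by (auto simp: supp_vec_def)
    then show ?thesis
      using assms 0 by (simp add: cosamp_0)
  next
    case (Suc k')
    then show ?thesis
      using cosamp_Suc[OF assms, of s k'] by (simp add: card_supp_best_sparse)
  qed
  then show "cosamp A u s k \<in> carrier_vec n" "card (supp_vec (cosamp A u s k)) \<le> s"
    by auto
qed

text \<open>Identification contributes 2 \<delta> |d| and two noise terms, least squares a third,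
  and pruning doubles the total. The order \<open>4 * s\<close> covers the support of
  \<open>x\<close> together with the at most \<open>3 * s\<close> indices in
  \<open>T\<close>.\<close>

lemma cosamp_contraction_sparse:
  assumes rip: "restricted_isometry A m n (4 * s) \<delta>" and "\<delta> < 1"
    and x: "x \<in> carrier_vec n" "card (supp_vec x) \<le> s" and e: "e \<in> carrier_vec m"
    and u: "u = A *\<^sub>v x + e"
  defines "a \<equiv> cosamp A u s"
  shows "(1 - \<delta>) * norm2_vec (x - a (Suc k))
    \<le> 4 * \<delta> * norm2_vec (x - a k) + 6 * sqrt (1 + \<delta>) * norm2_vec e"
proof -
  interpret restricted_isometry A m n "4 * s" \<delta>
    by (rule rip)
  have uc: "u \<in> carrier_vec m"
    using u e by simp
  have ak: "a k \<in> carrier_vec n" "card (supp_vec (a k)) \<le> s"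
    using cosamp_carrier_sparse[OF mat_carrier uc] by (simp_all add: a_def)
  define d where "d = x - a k"
  define \<Omega> where "\<Omega> = supp_vec (best_sparse (2 * s) (mat_adjoint A *\<^sub>v (A *\<^sub>v d + e)))"
  define T where "T = \<Omega> \<union> supp_vec (a k)"
  define b where "b = extend_vec n T (pseudo_inverse (column_submatrix A T) *\<^sub>v u)"
  have d: "d \<in> carrier_vec n" "supp_vec d \<subseteq> supp_vec x \<union> supp_vec (a k)"
    using x ak supp_vec_diff[OF x(1) ak(1)] by (simp_all add: d_def)
  have "card (supp_vec d) \<le> card (supp_vec x) + card (supp_vec (a k))"
    using d(2) card_mono[of "supp_vec x \<union> supp_vec (a k)" "supp_vec d"]
      card_Un_le[of "supp_vec x" "supp_vec (a k)"] by simp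
  then have card_d: "card (supp_vec d) \<le> 2 * s"
    using x ak by simp
  have "u - A *\<^sub>v a k = A *\<^sub>v d + e"
    using e mat_carrier x(1) ak(1) mult_diff[OF x(1) ak(1)]
    by (intro eq_vecI) (auto simp: d_def u)
  then have a_Suc: "a (Suc k) = best_sparse s b"
    using cosamp_Suc[OF mat_carrier uc, of s k] by (simp add: a_def b_def T_def \<Omega>_def)
  have "mat_adjoint A *\<^sub>v (A *\<^sub>v d + e) \<in> carrier_vec n"
    using mat_adjoint_carrier[OF mat_carrier] e by (intro mult_mat_vec_carrier) auto
  then have T: "T \<subseteq> {..<n}" "finite T"
    using ak supp_vec_subset[of _ n] by (simp_all add: T_def \<Omega>_def)
  have "card T \<le> card \<Omega> + card (supp_vec (a k))"
    unfolding T_def by (rule card_Un_le)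
  then have card_T: "card T \<le> 3 * s"
    using ak(2) card_supp_best_sparse[of "2 * s" "mat_adjoint A *\<^sub>v (A *\<^sub>v d + e)"]
    unfolding \<Omega>_def by linarith
  then have card_xT: "card (supp_vec x \<union> T) \<le> 4 * s"
    using card_Un_le[of "supp_vec x" T] x(2) by simp
  have b: "b \<in> carrier_vec n" "supp_vec b \<subseteq> T"
    by (simp_all add: b_def supp_extend_vec)
  \<comment> \<open>This makes the pseudo-inverse on \<open>T\<close> meaningful.\<close>
  have inj: "z = 0\<^sub>v n" if "z \<in> carrier_vec n" "supp_vec z \<subseteq> T" "A *\<^sub>v z = 0\<^sub>v m" for z
  proof -
    have "card (supp_vec z) \<le> 4 * s"
      using card_mono[OF T(2) that(2)] card_T by simp
    then show ?thesis
      using inj_on_sparse[OF \<open>\<delta> < 1\<close>] that by blast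
  qed
  have est: "(1 - \<delta>) * norm2_vec (x - b)
      \<le> norm2_vec (restrict_vec x (- T)) + sqrt (1 + \<delta>) * norm2_vec e"
    using x(1) b T(2) card_xT e
  proof (rule estimation)
    fix z assume z: "z \<in> carrier_vec n" "supp_vec z \<subseteq> T"
    have "rinner (A *\<^sub>v z) (u - A *\<^sub>v b) = 0"
      unfolding b_def
      by (rule extend_pseudo_inverse_normal_equations[OF mat_carrier T(1) uc _ z]) (rule inj)
    then show "rinner (A *\<^sub>v z) (A *\<^sub>v x + e - A *\<^sub>v b) = 0"
      unfolding u .
  qed
  \<comment> \<open>\<open>T\<close> contains the support of \<open>a k\<close>, so off
    \<open>T\<close> the error \<open>d\<close> is \<open>x\<close> itself.\<close>
  have "restrict_vec x (- T) = restrict_vec d (- T)"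
    using carrier_vecD[OF x(1)] carrier_vecD[OF ak(1)]
    by (intro eq_vecI) (auto simp: d_def T_def supp_vec_def)
  also have "norm2_vec \<dots> \<le> norm2_vec (restrict_vec d (- \<Omega>))"
    by (rule norm2_restrict_vec_mono) (auto simp: T_def)
  also have "\<dots> \<le> 2 * (\<delta> * norm2_vec d + sqrt (1 + \<delta>) * norm2_vec e)"
    unfolding \<Omega>_def by (rule identification[OF d(1) card_d _ e]) simp
  finally have est': "(1 - \<delta>) * norm2_vec (x - b) \<le> 2 * \<delta> * norm2_vec d + 3 * sqrt (1 + \<delta>) * norm2_vec e"
    using est by simp
  have "norm2_vec (x - a (Suc k)) \<le> norm2_vec (x - b) + norm2_vec (b - best_sparse s b)"
    unfolding a_Suc using x b by (intro norm2_vec_triangle_minus[of _ n]) auto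
  \<comment> \<open>The sparse signal \<open>x\<close> is itself a competitor for the best
    \<open>s\<close>-sparse approximation of \<open>b\<close>.\<close>
  also have "norm2_vec (b - best_sparse s b) \<le> norm2_vec (x - b)"
    using best_sparse_optimal[OF b(1) x] norm2_vec_minus_commute[OF b(1) x(1)] by simp
  finally have "(1 - \<delta>) * norm2_vec (x - a (Suc k)) \<le> (1 - \<delta>) * (2 * norm2_vec (x - b))"
    using \<open>\<delta> < 1\<close> by (intro mult_left_mono) auto
  then show ?thesis
    using est' by (simp add: d_def)
qed

theorem theorem2p1:
  fixes s m N :: nat and \<Phi> :: "complex mat" and x e u :: "complex vec" and \<nu> :: real
    and a :: "nat \<Rightarrow> complex vec"
  assumes "s > 0"
    and "\<Phi> \<in> carrier_mat m N"
    and "restricted_isometry_const (4 * s) \<Phi> \<le> 0.1"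
    and "x \<in> carrier_vec N"
    and "e \<in> carrier_vec m"
    and "u = \<Phi> *\<^sub>v x + e"
    and "\<nu> = norm2_vec (x - best_sparse s x)
             + 1 / sqrt (real s) * norm1_vec (x - best_sparse s x) + norm2_vec e"
    and "a = cosamp \<Phi> u s"
  shows "(\<forall>k. sparse_vec s (a k) \<and>
              norm2_vec (x - a (Suc k)) \<le> 0.5 * norm2_vec (x - a k) + 10 * \<nu>) \<and>
         (\<forall>k. norm2_vec (x - a k) \<le> 1 / 2 ^ k * norm2_vec x + 20 * \<nu>)"
proof -
  note x = assms(4) and e = assms(5)
  interpret restricted_isometry \<Phi> m N "4 * s" "0.1"
    using assms(1-3) by (intro restricted_isometryI) auto
  define h where "h = x - best_sparse s x"
  \<comment> \<open>The image of the tail counts as noise, so the sparse contraction applies to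
    \<open>best_sparse s x\<close>.\<close>
  define e' where "e' = \<Phi> *\<^sub>v h + e"
  define c where "c = sqrt (1 + 0.1 :: real)"
  \<comment> \<open>1.05^2 = 1.1025, which exceeds 1.1.\<close>
  have c: "0 \<le> c" "c \<le> 21 / 20"
    unfolding c_def by (simp, intro real_le_lsqrt) (simp_all add: power2_eq_square)
  have xs: "best_sparse s x \<in> carrier_vec N" "card (supp_vec (best_sparse s x)) \<le> s"
    using x card_supp_best_sparse by auto
  have h: "h \<in> carrier_vec N" and e': "e' \<in> carrier_vec m"
    using x xs e by (simp_all add: h_def e'_def)
  have u: "u = \<Phi> *\<^sub>v best_sparse s x + e'"
  proof -
    have "x = best_sparse s x + h"
      using x xs by (intro eq_vecI) (auto simp: h_def)
    then have "\<Phi> *\<^sub>v x = \<Phi> *\<^sub>v best_sparse s x + \<Phi> *\<^sub>v h"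
      using mult_add[OF xs(1) h] by simp
    then show ?thesis
      using e by (simp add: assms(6) e'_def assoc_add_vec[of _ m])
  qed
  have uc: "u \<in> carrier_vec m"
    using e by (simp add: assms(6))
  have ak: "a k \<in> carrier_vec N" "card (supp_vec (a k)) \<le> s" for k
    using cosamp_carrier_sparse[OF assms(2) uc] by (simp_all add: assms(8))
  define q where "q = norm1_vec h / sqrt s"
  have q: "0 \<le> q"
    by (simp add: q_def norm1_vec_def sum_nonneg)
  have \<nu>: "\<nu> = norm2_vec h + q + norm2_vec e"
    by (simp add: assms(7) h_def q_def)
  have \<nu>_nonneg: "0 \<le> \<nu>"
    using q by (simp add: \<nu>)
  have "norm2_vec e' \<le> c * (norm2_vec h + q) + norm2_vec e"
    using norm2_vec_triangle[of "\<Phi> *\<^sub>v h" m e] norm2_mult_le_norm1[OF assms(1) _ h] e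
    by (simp add: e'_def c_def q_def)
  also have "\<dots> \<le> 21 / 20 * (norm2_vec h + q) + norm2_vec e"
    using c q by (intro add_right_mono mult_right_mono) auto
  finally have e'_le: "norm2_vec e' \<le> 21 / 20 * (norm2_vec h + q) + norm2_vec e" .
  have step: "norm2_vec (x - a (Suc k)) \<le> 1 / 2 * norm2_vec (x - a k) + 10 * \<nu>" for k
  proof -
    have "(1 - 0.1) * norm2_vec (best_sparse s x - a (Suc k))
        \<le> 4 * 0.1 * norm2_vec (best_sparse s x - a k) + 6 * c * norm2_vec e'"
      unfolding assms(8) c_def
      by (rule cosamp_contraction_sparse[OF restricted_isometry_axioms _ xs e' u]) simp
    then have "9 / 10 * norm2_vec (best_sparse s x - a (Suc k))
        \<le> 2 / 5 * norm2_vec (best_sparse s x - a k) + 6 * c * norm2_vec e'"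
      by simp
    also have "6 * c * norm2_vec e' \<le> 63 / 10 * norm2_vec e'"
      using c by (intro mult_right_mono) auto
    finally have "9 / 10 * norm2_vec (best_sparse s x - a (Suc k))
        \<le> 2 / 5 * norm2_vec (best_sparse s x - a k) + 63 / 10 * norm2_vec e'"
      by simp
    moreover have "norm2_vec (x - a (Suc k)) \<le> norm2_vec h + norm2_vec (best_sparse s x - a (Suc k))"
      unfolding h_def using x xs ak by (intro norm2_vec_triangle_minus[of _ N]) auto
    moreover have "norm2_vec (best_sparse s x - a k) \<le> norm2_vec h + norm2_vec (x - a k)"
      using norm2_vec_triangle_minus[OF xs(1) x ak(1)] norm2_vec_minus_commute[OF xs(1) x]
      by (simp add: h_def)
    \<comment> \<open>Dividing by 0.9 gives the factor 4/9 and noise weight 7. The coefficient of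
      |h| is 1 + 4/9 + 7.35 < 10; those of \<open>q\<close> and |e| are 7.35 and 7.\<close>
    ultimately show ?thesis
      using e'_le q norm2_vec_nonneg[of h] norm2_vec_nonneg[of e] norm2_vec_nonneg[of "x - a k"]
      unfolding \<nu> by argo
  qed
  have bound: "norm2_vec (x - a k) \<le> 1 / 2 ^ k * norm2_vec x + 20 * \<nu>" for k
  proof (induction k)
    case 0
    have "x - a 0 = x"
      using x assms(2) by (intro eq_vecI) (auto simp: assms(8) cosamp_0)
    then show ?case
      using \<nu>_nonneg by simp
  next
    case (Suc k)
    \<comment> \<open>20 \<nu> is the fixed point of the map sending t to t/2 + 10 \<nu>.\<close>
    have "norm2_vec (x - a (Suc k)) \<le> 1 / 2 * (1 / 2 ^ k * norm2_vec x + 20 * \<nu>) + 10 * \<nu>"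
      using step[of k] Suc.IH by argo
    also have "\<dots> = 1 / 2 ^ Suc k * norm2_vec x + 20 * \<nu>"
      by (simp add: field_simps)
    finally show ?case .
  qed
  show ?thesis
    using step bound ak(2) by (simp add: sparse_vec_def norm0_vec_def)
qed

end
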